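(* Let $N$ be a nonnegative integer and let $t,b,c,d_1,d_2,e,f,\sigma,\beta,\delta_1,\delta_2,\phi$ be nonzero complex numbers, generic in the sense that no denominator below vanishes, such that $$t^3\sigma^2q^{N+3}=b\,c\,d_1d_2\,ef\,\beta\delta_1\delta_2\phi .$$ Then $$\sum_{K=0}^{N}\frac{(b/t,\ c/t,\ d_1/t,\ d_2/t,\ \sigma q,\ \phi,\ q^{-N})_K}{(q,\ 1/t,\ q/e,\ q/f,\ \sigma q/\beta,\ \sigma q/\delta_1,\ \sigma q/\delta_2)_K}\,q^K$$ $$\times\ {}_{10}W_9\left[tq^{-K};\,b,c,d_1,d_2,eq^{-K},fq^{-K},q^{-K};\,q;\,\frac{t^3q^3}{bcd_1d_2ef}\right]$$ $$\times\ {}_{8}W_7\left[\sigma q^K;\,\beta,\delta_1,\delta_2,\phi q^K,q^{K-N};\,q;\,\frac{\sigma^2q^{N+2}}{\beta\delta_1\delta_2\phi}\right]$$ $$=\phi^N\,\frac{(\sigma q,\ \sigma q/(\beta\phi),\ \sigma q/(\delta_1\phi),\ \sigma q/(\delta_2\phi))_N}{(\sigma q/\beta,\ \sigma q/\phi,\ \sigma q/\delta_1,\ \sigma q/\delta_2)_N}$$ $$\times\sum_{L=0}^{N}\frac{(tq/(bf),\ tq/(cf),\ tq/(d_1f),\ tq/(d_2f),\ q^{-N}\phi/\sigma,\ \phi,\ q^{-N})_L}{(q,\ e/f,\ tq/f,\ q/f,\ q^{-N}\phi\beta/\sigma,\ q^{-N}\delta_1\phi/\sigma,\ q^{-N}\delta_2\phi/\sigma)_L}\,q^L$$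 $$\times\ {}_{10}W_9\left[fq^{-L}/e;\,\frac{tq}{ce},\frac{tq}{be},\frac{tq}{d_1e},\frac{tq}{d_2e},\frac{fq^{-L}}{t},fq^{-L},q^{-L};\,q;\,\frac{bcd_1d_2ef\,q^{-1}}{t^3}\right].$$
   Context: Fix a complex number $q$ with $0<|q|<1$. For $k\in\mathbb N=\{0,1,2,\dots\}$, $(a)_k=(a;q)_k=\prod_{i=0}^{k-1}(1-aq^i)$, and $(a_1,\dots,a_r)_k=(a_1)_k\cdots(a_r)_k$. The very well-poised basic hypergeometric series is $${}_{n+1}W_n[a_0;a_3,\dots,a_n;q;u]=\sum_{k\in\mathbb N}\frac{1-a_0q^{2k}}{1-a_0}\,\frac{(a_0)_k(a_3)_k\cdots(a_n)_k}{(q)_k(a_0q/a_3)_k\cdots(a_0q/a_n)_k}\,u^k .$$ All $W$-series in the claim terminate: when the last listed parameter is $q^{-M}$ with $M$ a nonnegative integer, the series is read as the finite sum over $0\le k\le M$. *)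

theory Defs
  imports Complex_Main
begin

definition qpoch :: "complex \<Rightarrow> complex \<Rightarrow> nat \<Rightarrow> complex" where
  "qpoch a q k = (\<Prod>i<k. 1 - a * q ^ i)"

definition qpochs :: "complex list \<Rightarrow> complex \<Rightarrow> nat \<Rightarrow> complex" where
  "qpochs as q k = (\<Prod>a\<leftarrow>as. qpoch a q k)"

text \<open>
  The list \<open>as\<close> holds the parameters $a_3, \dots, a_n$ of ${}_{n+1}W_n$, so it has length $n - 2$
  (seven entries for ${}_{10}W_9$, five for ${}_8W_7$).
\<close>

definition W_term :: "complex \<Rightarrow> complex list \<Rightarrow> complex \<Rightarrow> complex \<Rightarrow> nat \<Rightarrow> complex" where
  "W_term a0 as q u k =
     (1 - a0 * q ^ (2 * k)) / (1 - a0) *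
     (qpochs (a0 # as) q k / qpochs (q # map (\<lambda>a. a0 * q / a) as) q k) * u ^ k"

definition W :: "complex \<Rightarrow> complex list \<Rightarrow> complex \<Rightarrow> complex \<Rightarrow> complex" where
  "W a0 as q u = (\<Sum>k. W_term a0 as q u k)"

text \<open>
  No denominator vanishes in the terms $0 \le k \le M$ of the series.
\<close>

definition W_generic :: "complex \<Rightarrow> complex list \<Rightarrow> complex \<Rightarrow> nat \<Rightarrow> bool" where
  "W_generic a0 as q M \<longleftrightarrow>
     1 - a0 \<noteq> 0 \<and> (\<forall>k\<le>M. qpochs (q # map (\<lambda>a. a0 * q / a) as) q k \<noteq> 0)"

text \<open>
  When the last parameter is $q^{-M}$, every term with $k > M$ is $0$ because of its numerator, also
  if its denominator vanishes (division by $0$ gives $0$). So \<open>W\<close> is then the finite sum over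
  $0 \le k \le M$, with no assumption on the other parameters.
\<close>

lemma W_terminating:
  assumes "q \<noteq> 0" and "as \<noteq> []" and "last as = q powi (- int M)"
  shows "W a0 as q u = (\<Sum>k\<le>M. W_term a0 as q u k)"
proof -
  have "W_term a0 as q u k = 0" if "k \<notin> {..M}" for k
  proof -
    have "1 - last as * q ^ M = 0"
      using assms by (simp add: power_int_minus)
    moreover have "M < k"
      using that by simp
    ultimately have "qpoch (last as) q k = 0"
      unfolding qpoch_def by (intro prod_zero) auto
    moreover have "last as \<in> set (a0 # as)"
      using assms(2) by simp
    ultimately have "0 \<in> set (map (\<lambda>a. qpoch a q k) (a0 # as))"
      by (metis image_eqI list.set_map)
    then have "qpochs (a0 # as) q k = 0"
      unfolding qpochs_def by (subst prod_list_zero_iff)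
    then show ?thesis
      by (simp add: W_term_def)
  qed
  then show ?thesis
    unfolding W_def by (intro suminf_finite) auto
qed

end

theory Submission
  imports Defs "HOL-Computational_Algebra.Polynomial" "HOL-Computational_Algebra.Formal_Power_Series"
begin

text \<open>
  Each of the three series is, up to an elementary factor, a coefficient of a double generating
  function. Multiplied by \<open>(b/t, c/t, d1/t, d2/t)_K / (q, 1/t, q/e, q/f)_K\<close>, the 10W9 series at \<open>K\<close>
  on the left is the coefficient of \<open>u^K\<close> in the sum over \<open>j, m\<close> of \<open>u^(j+m) (t q^j - q^m) / (t - 1)\<close> times a quotient of pairs
  \<open>(p)_j (p/t)_m\<close>, with \<open>p\<close> running through \<open>b, c, d1, d2\<close> in the numerator and through
  \<open>q, tq, tq/e, tq/f\<close> in the denominator (\<open>vwp_sum_eq_W\<close>). Call this generating function \<open>F(u)\<close>.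

  The heart of the proof is an Euler transformation of Kajihara type (\<open>euler_transformation\<close>),
  \<open>F(u) = (A u)_\<infinity> / (u)_\<infinity> F'(A u)\<close> with \<open>A = b c d1 d2 e f / (t^3 q^2)\<close>, where \<open>F'\<close> has the
  same shape with \<open>t\<close> replaced by \<open>f/e\<close> and \<open>p\<close> by \<open>tq/(pe)\<close>; the coefficients of \<open>F'\<close> are the
  10W9 series on the right. The 8W7 series are coefficients of \<open>u^(N-K)\<close> in a degenerate case, whose
  right-hand side is \<open>(B u)_\<infinity> / (u)_\<infinity> G(B u)\<close> with \<open>B = \<beta> \<delta>1 \<delta>2 \<phi> / (\<sigma>^2 q^(N+1))\<close> and a \<open>G\<close>
  with factorised coefficients (\<open>terminating_8W7\<close>, \<open>one_pair_transformation\<close>). The left-hand side of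
  the theorem is therefore a coefficient of
  \<open>F(B u) (B u)_\<infinity> / (u)_\<infinity> G(B u)\<close>, and the balancing condition says exactly that \<open>A B = 1\<close>, so
  that the four infinite products cancel and \<open>F'(u) G(B u)\<close> remains (\<open>euler_convolution\<close>). Its
  coefficient of \<open>u^N\<close> is the right-hand side.

  The Euler transformation itself comes from one contiguous relation in two of the numerator
  parameters,
  \<open>c (1 - b) (1 - b/t) D(bq, c) - b (1 - c) (1 - c/t) D(b, cq) = (c - b) (1 - b c q^n / t) D(b, c)\<close>.
  For the left-hand side it holds term by term; for the right-hand side it holds up to a
  telescoping sum whose weights come from Lagrange interpolation in two nodes. The difference \<open>D\<close> of
  the sides is a polynomial of degree at most \<open>n\<close> in each parameter, and at \<open>b = q^(-s)\<close> the
  relation degenerates to a recursion in \<open>c\<close> whose polynomial solutions are the multiples of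
  \<open>(c)_s (c/t)_(n-s)\<close>. Hence \<open>D\<close> vanishes identically once it vanishes for one value of \<open>c\<close>
  (\<open>contiguous_eq_0\<close>). Moving \<open>d1\<close> to \<open>tq/e\<close> and \<open>d2\<close> to \<open>tq/f\<close> in this way cancels both denominator
  pairs and leaves the terminating 6W5 sum.
\<close>

section \<open>Shifted factorials\<close>

lemma qpoch_0 [simp]: "qpoch a q 0 = 1"
  by (simp add: qpoch_def)

lemma qpoch_Suc: "qpoch a q (Suc n) = qpoch a q n * (1 - a * q ^ n)"
  by (simp add: qpoch_def)

lemma qpoch_rec: "qpoch a q (Suc n) = (1 - a) * qpoch (a * q) q n"
  unfolding qpoch_def by (subst prod.lessThan_Suc_shift) (simp add: mult_ac)

lemma qpoch_shift: "(1 - a) * qpoch (a * q) q n = qpoch a q n * (1 - a * q ^ n)"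
  by (metis qpoch_Suc qpoch_rec)

lemma qpoch_add: "qpoch a q (m + n) = qpoch a q m * qpoch (a * q ^ m) q n"
  by (induction n) (simp_all add: qpoch_Suc power_add mult_ac)

lemma qpoch_eq_0_iff: "qpoch a q n = 0 \<longleftrightarrow> (\<exists>i<n. a * q ^ i = 1)"
  by (auto simp: qpoch_def)

lemma qpoch_nonzero_mono: "qpoch a q n \<noteq> 0 \<Longrightarrow> m \<le> n \<Longrightarrow> qpoch a q m \<noteq> 0"
  by (auto simp: qpoch_eq_0_iff)

lemma power_Suc_neq_1:
  fixes q :: complex
  assumes "norm q < 1"
  shows "q ^ Suc n \<noteq> 1"
proof
  assume "q ^ Suc n = 1"
  then have "norm q ^ Suc n = 1"
    by (metis norm_one norm_power)
  moreover have "norm q ^ Suc n \<le> norm q"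
    using assms power_decreasing[of 1 "Suc n" "norm q"] by simp
  ultimately show False
    using assms by simp
qed

lemma qpoch_qq_nonzero: "norm q < 1 \<Longrightarrow> qpoch q q n \<noteq> 0"
  using power_Suc_neq_1[of q] by (auto simp: qpoch_eq_0_iff)

text \<open>
  The factor \<open>(-1)^j q^(j(j-1)/2)\<close> of a reversed shifted factorial, as a product in order to avoid
  halving the exponent.
\<close>
definition qsgn :: "complex \<Rightarrow> nat \<Rightarrow> complex" where
  "qsgn q j = (\<Prod>i<j. - (q ^ i))"

lemma qsgn_nonzero: "q \<noteq> 0 \<Longrightarrow> qsgn q j \<noteq> 0"
  by (simp add: qsgn_def)

lemma qsgn_square: "qsgn q j * qsgn q j * q ^ j = q ^ (j * j)"
proof (induction j)
  case (Suc j)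
  have "qsgn q (Suc j) * qsgn q (Suc j) * q ^ Suc j = (qsgn q j * qsgn q j * q ^ j) * (q ^ j * q ^ j * q)"
    by (simp add: qsgn_def mult_ac)
  also have "\<dots> = q ^ (Suc j * Suc j)"
    unfolding Suc by (simp add: power_add mult_ac)
  finally show ?case .
qed (simp add: qsgn_def)

text \<open>
  Reading the last \<open>j\<close> factors backwards turns \<open>1 - r q^i\<close> into \<open>1 - q^(-i)/r\<close>. This moves the
  \<open>q^(-K)\<close> dependence of the parameters of a series at \<open>K\<close> into the length of the factorials.
\<close>
lemma qpoch_reverse:
  assumes "q \<noteq> 0" and "r \<noteq> 0"
  shows "qpoch r q (m + j) = qpoch r q m * qpoch (q / (r * q ^ (m + j))) q j * ((r * q ^ m) ^ j * qsgn q j)"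
proof -
  have "qpoch (r * q ^ m) q j = (\<Prod>i<j. (1 - q / (r * q ^ (m + j)) * q ^ (j - Suc i)) * (r * q ^ m * - (q ^ i)))"
    unfolding qpoch_def
  proof (intro prod.cong refl)
    fix i assume "i \<in> {..<j}"
    then obtain k where "j = Suc (i + k)"
      using less_imp_Suc_add by auto
    then have "q ^ (m + j) = q ^ m * q ^ i * q * q ^ (j - Suc i)"
      by (simp add: power_add mult_ac)
    then show "1 - r * q ^ m * q ^ i = (1 - q / (r * q ^ (m + j)) * q ^ (j - Suc i)) * (r * q ^ m * - (q ^ i))"
      using assms by (simp add: field_simps)
  qed
  also have "\<dots> = (\<Prod>i<j. 1 - q / (r * q ^ (m + j)) * q ^ (j - Suc i)) * ((r * q ^ m) ^ j * qsgn q j)"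
    unfolding prod.distrib qsgn_def by (simp only: prod_constant card_lessThan power_mult_distrib)
  also have "(\<Prod>i<j. 1 - q / (r * q ^ (m + j)) * q ^ (j - Suc i)) = qpoch (q / (r * q ^ (m + j))) q j"
    unfolding qpoch_def by (rule prod.nat_diff_reindex)
  finally show ?thesis
    unfolding qpoch_add by simp
qed

text \<open>
  A numerator parameter \<open>p\<close> of a sum over \<open>j + m = n\<close> with the two variables \<open>t\<close> and \<open>1\<close>. All factors
  other than the Vandermonde quotient \<open>(t q^j - q^m) / (t - 1)\<close> have this form, those in the
  denominator included, so a denominator pair cancels against an equal numerator pair.
\<close>
definition qpair :: "complex \<Rightarrow> complex \<Rightarrow> complex \<Rightarrow> nat \<Rightarrow> nat \<Rightarrow> complex" where
  "qpair q t p j m = qpoch p q j * qpoch (p / t) q m"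

lemma qpair_shift:
  "(1 - p) * (1 - p / t) * qpair q t (p * q) j m =
     (1 - p * q ^ j) * (1 - p / t * q ^ m) * qpair q t p j m"
proof -
  have "(1 - p) * (1 - p / t) * qpair q t (p * q) j m
      = ((1 - p) * qpoch (p * q) q j) * ((1 - p / t) * qpoch (p / t * q) q m)"
    by (simp add: qpair_def mult_ac)
  then show ?thesis
    by (simp only: qpoch_shift) (simp add: qpair_def mult_ac)
qed

lemma qpair_Suc_left: "qpair q t p (Suc j) m = (1 - p * q ^ j) * qpair q t p j m"
  and qpair_Suc_right: "qpair q t p j (Suc m) = (1 - p / t * q ^ m) * qpair q t p j m"
  by (simp_all add: qpair_def qpoch_Suc mult_ac)

text \<open>
  This is \<open>p^j (aq/p)_j\<close>, written as a polynomial in \<open>p\<close> so that \<open>p = 0\<close> is a legal value.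
\<close>
definition qfall :: "complex \<Rightarrow> complex \<Rightarrow> complex \<Rightarrow> nat \<Rightarrow> complex" where
  "qfall q a p j = (\<Prod>i<j. p - a * q ^ Suc i)"

lemma qfall_0 [simp]: "qfall q a p 0 = 1"
  by (simp add: qfall_def)

lemma qfall_Suc: "qfall q a p (Suc j) = (p - a * q ^ Suc j) * qfall q a p j"
  by (simp add: qfall_def)

lemma qfall_shift: "qfall q a (p * q) (Suc j) = q ^ Suc j * ((p - a) * qfall q a p j)"
proof -
  have "qfall q a (p * q) (Suc j) = (\<Prod>i<Suc j. q * (p - a * q ^ i))"
    unfolding qfall_def by (intro prod.cong) (auto simp: algebra_simps)
  also have "\<dots> = q ^ Suc j * (\<Prod>i<Suc j. p - a * q ^ i)"
    by (simp add: prod.distrib)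
  also have "(\<Prod>i<Suc j. p - a * q ^ i) = (p - a) * qfall q a p j"
    unfolding qfall_def by (subst prod.lessThan_Suc_shift) simp
  finally show ?thesis .
qed

lemma qfall_eq_qpoch:
  assumes "p \<noteq> 0"
  shows "qfall q a p n = p ^ n * qpoch (a * q / p) q n"
proof -
  have "qfall q a p n = (\<Prod>i<n. p * (1 - a * q / p * q ^ i))"
    unfolding qfall_def by (intro prod.cong refl) (use assms in \<open>simp add: field_simps\<close>)
  then show ?thesis
    unfolding qpoch_def prod.distrib by simp
qed

section \<open>Convolutions of q-binomial series\<close>

text \<open>
  The device behind the recursions in \<open>n\<close> below: a summand on the diagonal \<open>n + 1\<close>, split into a part
  inherited from \<open>(j - 1, m)\<close> and a part inherited from \<open>(j, m - 1)\<close>, is collected on the diagonal \<open>n\<close>.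
\<close>
lemma antidiagonal_Suc:
  fixes C D :: "nat \<Rightarrow> nat \<Rightarrow> complex"
  assumes "\<And>m. C 0 m = 0" and "\<And>j. D j 0 = 0"
  shows "(\<Sum>j\<le>Suc n. C j (Suc n - j) + D j (Suc n - j)) = (\<Sum>j\<le>n. C (Suc j) (n - j) + D j (Suc (n - j)))"
proof -
  have "(\<Sum>j\<le>Suc n. C j (Suc n - j)) = (\<Sum>j\<le>n. C (Suc j) (n - j))"
    by (subst sum.atMost_Suc_shift) (simp add: assms)
  moreover have "(\<Sum>j\<le>Suc n. D j (Suc n - j)) = (\<Sum>j\<le>n. D j (Suc (n - j)))"
    by (simp add: assms Suc_diff_le)
  ultimately show ?thesis
    by (simp only: sum.distrib)
qed

text \<open>
  By the q-binomial theorem, the coefficient of \<open>u^n\<close> in \<open>(a u)_\<infinity> / (u)_\<infinity>\<close>.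
\<close>
definition qbin :: "complex \<Rightarrow> complex \<Rightarrow> nat \<Rightarrow> complex" where
  "qbin q a n = qpoch a q n / qpoch q q n"

lemma qbin_0 [simp]: "qbin q a 0 = 1"
  by (simp add: qbin_def)

text \<open>
  The last two identities are \<open>(a u)_\<infinity> = (1 - a u) (a q u)_\<infinity>\<close> and \<open>(q u)_\<infinity> = (u)_\<infinity> / (1 - u)\<close>
  on the level of coefficients.
\<close>
lemma
  assumes "norm q < 1"
  shows qbin_Suc: "(1 - q ^ Suc n) * qbin q a (Suc n) = (1 - a * q ^ n) * qbin q a n"
    and qbin_shift: "qbin q a (Suc n) = qbin q (a * q) (Suc n) - a * qbin q (a * q) n"
    and qbin_shift': "q ^ Suc n * qbin q a (Suc n) = qbin q (a * q) (Suc n) - qbin q (a * q) n"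
proof -
  have nz: "1 - q ^ Suc n \<noteq> 0" "qpoch q q n \<noteq> 0"
    using power_Suc_neq_1[OF assms, of n] qpoch_qq_nonzero[OF assms] by auto
  have 1: "qpoch q q (Suc n) = (1 - q ^ Suc n) * qpoch q q n"
    by (simp add: qpoch_Suc mult_ac)
  show "(1 - q ^ Suc n) * qbin q a (Suc n) = (1 - a * q ^ n) * qbin q a n"
    using nz unfolding qbin_def 1 qpoch_Suc[of a]
    by (simp only: times_divide_eq_right nonzero_mult_divide_mult_cancel_left not_False_eq_True)
       (simp only: mult_ac)
  define u where "u = qpoch (a * q) q n / ((1 - q ^ Suc n) * qpoch q q n)"
  have u: "qbin q a (Suc n) = (1 - a) * u" "qbin q (a * q) (Suc n) = (1 - a * q ^ Suc n) * u"
    "qbin q (a * q) n = (1 - q ^ Suc n) * u"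
    unfolding qbin_def 1 u_def qpoch_rec[of a] using nz
    by (simp_all add: qpoch_Suc mult_ac)
  show "qbin q a (Suc n) = qbin q (a * q) (Suc n) - a * qbin q (a * q) n"
    "q ^ Suc n * qbin q a (Suc n) = qbin q (a * q) (Suc n) - qbin q (a * q) n"
    unfolding u by algebra+
qed

text \<open>
  Coefficient form of \<open>g(u) F(u) = h(u) (1 - a u) F(u)\<close> for \<open>g(u) = (1 - a u) h(u)\<close>.
\<close>
lemma convolution_difference:
  fixes g h F :: "nat \<Rightarrow> complex"
  assumes "g 0 = h 0" and "\<And>n. g (Suc n) = h (Suc n) - a * h n"
  shows "(\<Sum>l\<le>n. g (n - l) * F l) =
    (\<Sum>l\<le>n. h (n - l) * (F l - a * (case l of 0 \<Rightarrow> 0 | Suc k \<Rightarrow> F k)))"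
proof (cases n)
  case 0
  then show ?thesis using assms by simp
next
  case (Suc k)
  have "(\<Sum>l\<le>n. g (n - l) * F l) = (\<Sum>l\<le>k. g (Suc (k - l)) * F l) + g 0 * F (Suc k)"
    unfolding Suc by (simp add: Suc_diff_le)
  also have "\<dots> = (\<Sum>l\<le>k. h (Suc (k - l)) * F l) + h 0 * F (Suc k) - (\<Sum>l\<le>k. h (k - l) * (a * F l))"
    by (simp add: assms ring_distribs sum_subtractf mult_ac)
  also have "(\<Sum>l\<le>k. h (Suc (k - l)) * F l) + h 0 * F (Suc k) = (\<Sum>l\<le>n. h (n - l) * F l)"
    unfolding Suc by (simp add: Suc_diff_le)
  also have "(\<Sum>l\<le>k. h (k - l) * (a * F l)) = (\<Sum>l\<le>n. h (n - l) * (a * (case l of 0 \<Rightarrow> 0 | Suc k \<Rightarrow> F k)))"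
    unfolding Suc by (subst sum.atMost_Suc_shift) simp
  finally show ?thesis
    by (simp add: ring_distribs sum_subtractf)
qed

text \<open>
  Coefficient form of \<open>(a b u)_\<infinity> / (b u)_\<infinity> * (b u)_\<infinity> / (u)_\<infinity> = (a b u)_\<infinity> / (u)_\<infinity>\<close>.
\<close>
lemma qbin_convolution:
  assumes "norm q < 1"
  shows "(\<Sum>i\<le>n. qbin q a i * b ^ i * qbin q b (n - i)) = qbin q (a * b) n"
proof (induction n)
  case 0
  then show ?case by simp
next
  case (Suc n)
  \<comment> \<open>This comes from \<open>1 - q^(j+m) = (1 - q^m) + q^m (1 - q^j)\<close>.\<close>
  define C where "C j m = (1 - q ^ j) * q ^ m * (qbin q a j * b ^ j * qbin q b m)" for j m
  define D where "D j m = (1 - q ^ m) * (qbin q a j * b ^ j * qbin q b m)" for j m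
  have C: "C (Suc j) m = q ^ m * b * (1 - a * q ^ j) * (qbin q a j * b ^ j * qbin q b m)" for j m
  proof -
    have "C (Suc j) m = ((1 - q ^ Suc j) * qbin q a (Suc j)) * q ^ m * b ^ Suc j * qbin q b m"
      by (simp only: C_def mult_ac)
    then show ?thesis
      unfolding qbin_Suc[OF assms] by simp
  qed
  have D: "D j (Suc m) = (1 - b * q ^ m) * (qbin q a j * b ^ j * qbin q b m)" for j m
  proof -
    have "D j (Suc m) = ((1 - q ^ Suc m) * qbin q b (Suc m)) * qbin q a j * b ^ j"
      by (simp only: D_def mult_ac)
    then show ?thesis
      unfolding qbin_Suc[OF assms] by simp
  qed
  have CD: "C j m + D j m = (1 - q ^ (j + m)) * (qbin q a j * b ^ j * qbin q b m)" for j m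
    unfolding C_def D_def power_add by algebra
  have CD': "C (Suc j) m + D j (Suc m) = (1 - a * b * q ^ (j + m)) * (qbin q a j * b ^ j * qbin q b m)" for j m
    unfolding C D power_add by algebra
  have "(1 - q ^ Suc n) * (\<Sum>i\<le>Suc n. qbin q a i * b ^ i * qbin q b (Suc n - i))
      = (\<Sum>i\<le>Suc n. C i (Suc n - i) + D i (Suc n - i))"
    unfolding CD sum_distrib_left by (intro sum.cong) auto
  also have "\<dots> = (\<Sum>j\<le>n. C (Suc j) (n - j) + D j (Suc (n - j)))"
    by (rule antidiagonal_Suc) (auto simp: C_def D_def)
  also have "\<dots> = (1 - a * b * q ^ n) * qbin q (a * b) n"
    unfolding CD' Suc.IH[symmetric] sum_distrib_left by (intro sum.cong) auto
  also have "\<dots> = (1 - q ^ Suc n) * qbin q (a * b) (Suc n)"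
    by (simp only: qbin_Suc[OF assms])
  finally show ?case
    using power_Suc_neq_1[OF assms, of n] by (simp del: power_Suc)
qed

text \<open>
  If \<open>a w = 1\<close>, the series \<open>(a w u)_\<infinity> / (w u)_\<infinity>\<close> and \<open>(w u)_\<infinity> / (u)_\<infinity>\<close> are inverse to each other.
  Hence two sequences that are convolved with their coefficients multiply as if neither were there.
\<close>
lemma euler_convolution:
  fixes x y :: "nat \<Rightarrow> complex"
  assumes q: "norm q < 1" and aw: "a * w = 1"
  shows "(\<Sum>k\<le>n. w ^ k * (\<Sum>l\<le>k. qbin q a (k - l) * x l) * (\<Sum>l\<le>n - k. qbin q w (n - k - l) * y l))
    = (\<Sum>l\<le>n. w ^ l * x l * y (n - l))"
proof -
  define A where "A = Abs_fps (\<lambda>i. qbin q a i * w ^ i)"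
  define B where "B = Abs_fps (qbin q w)"
  define X where "X = Abs_fps (\<lambda>l. w ^ l * x l)"
  define Y where "Y = Abs_fps y"
  have AB: "A * B = 1"
  proof (rule fps_ext)
    fix k
    have "qbin q 1 k = (if k = 0 then 1 else 0)"
      by (cases k) (simp_all add: qbin_def qpoch_rec)
    then show "fps_nth (A * B) k = fps_nth 1 k"
      using qbin_convolution[OF q, of a w k] aw
      by (simp add: A_def B_def fps_mult_nth atLeast0AtMost)
  qed
  have "(X * A) * (Y * B) = (X * Y) * (A * B)"
    by (simp only: mult_ac)
  then have prod: "fps_nth ((X * A) * (Y * B)) n = fps_nth (X * Y) n"
    by (simp only: AB mult_1_right)
  have XA: "fps_nth (X * A) k = w ^ k * (\<Sum>l\<le>k. qbin q a (k - l) * x l)" for k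
    unfolding fps_mult_nth atLeast0AtMost sum_distrib_left
  proof (intro sum.cong refl)
    fix l assume "l \<in> {..k}"
    then have "w ^ k = w ^ l * w ^ (k - l)"
      by (simp flip: power_add)
    then show "fps_nth X l * fps_nth A (k - l) = w ^ k * (qbin q a (k - l) * x l)"
      by (simp add: X_def A_def)
  qed
  have YB: "fps_nth (Y * B) k = (\<Sum>l\<le>k. qbin q w (k - l) * y l)" for k
    by (simp add: fps_mult_nth atLeast0AtMost Y_def B_def mult.commute)
  have XY: "fps_nth (X * Y) n = (\<Sum>l\<le>n. w ^ l * x l * y (n - l))"
    by (simp add: fps_mult_nth atLeast0AtMost X_def Y_def)
  show ?thesis
    using prod unfolding XY fps_mult_nth[of "X * A"] XA YB atLeast0AtMost .
qed

section \<open>Very well-poised sums and their contiguous relation\<close>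

text \<open>
  The homogeneous part of degree \<open>n\<close> of a Kajihara series in the variables \<open>t\<close> and \<open>1\<close>; here
  \<open>a\<^sub>1 = t/e\<close> and \<open>a\<^sub>2 = t/f\<close> in the notation of the theorem. The second summation index \<open>m = n - j\<close>
  makes it a terminating 10W9 series.
\<close>
definition vwp_sum ::
  "complex \<Rightarrow> complex \<Rightarrow> complex \<Rightarrow> complex \<Rightarrow> complex \<Rightarrow> complex \<Rightarrow> complex \<Rightarrow> complex \<Rightarrow> nat \<Rightarrow> complex" where
  "vwp_sum q t b c d\<^sub>1 d\<^sub>2 a\<^sub>1 a\<^sub>2 n =
     (\<Sum>j\<le>n. (t * q ^ j - q ^ (n - j)) / (t - 1) *
       (qpair q t b j (n - j) * qpair q t c j (n - j) * qpair q t d\<^sub>1 j (n - j) * qpair q t d\<^sub>2 j (n - j))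
       / (qpair q t q j (n - j) * qpair q t (t * q) j (n - j) *
          qpair q t (a\<^sub>1 * q) j (n - j) * qpair q t (a\<^sub>2 * q) j (n - j)))"

text \<open>
  A shift of \<open>p\<close> multiplies the summand by \<open>(1 - p q^j) (1 - p q^m / t)\<close>, and in
  \<open>c (1 - b q^j) (1 - b q^m / t) - b (1 - c q^j) (1 - c q^m / t)\<close> the terms linear in \<open>q^j\<close> and \<open>q^m\<close>
  cancel, so that only \<open>q^(j+m) = q^n\<close> survives and leaves the sum.
\<close>
lemma vwp_sum_contiguous:
  "c * (1 - b) * (1 - b / t) * vwp_sum q t (b * q) c d\<^sub>1 d\<^sub>2 a\<^sub>1 a\<^sub>2 n
     - b * (1 - c) * (1 - c / t) * vwp_sum q t b (c * q) d\<^sub>1 d\<^sub>2 a\<^sub>1 a\<^sub>2 n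
   = (c - b) * (1 - b * c / t * q ^ n) * vwp_sum q t b c d\<^sub>1 d\<^sub>2 a\<^sub>1 a\<^sub>2 n"
proof -
  have *: "c * ((1 - b) * (1 - b / t) * qpair q t (b * q) j m) * qpair q t c j m
      - b * ((1 - c) * (1 - c / t) * qpair q t (c * q) j m) * qpair q t b j m
      = (c - b) * (1 - b * c / t * q ^ (j + m)) * (qpair q t b j m * qpair q t c j m)" for j m
    unfolding qpair_shift unfolding power_add divide_inverse by algebra
  have "c * (1 - b) * (1 - b / t) * (V * (qpair q t (b * q) j m * qpair q t c j m * P * Q) / R)
      - b * (1 - c) * (1 - c / t) * (V * (qpair q t b j m * qpair q t (c * q) j m * P * Q) / R)
      = (c - b) * (1 - b * c / t * q ^ (j + m)) * (V * (qpair q t b j m * qpair q t c j m * P * Q) / R)"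
    (is "?L = ?M") for V P Q R j m
  proof -
    have "?L = (V * P * Q / R) * (c * ((1 - b) * (1 - b / t) * qpair q t (b * q) j m) * qpair q t c j m
      - b * ((1 - c) * (1 - c / t) * qpair q t (c * q) j m) * qpair q t b j m)"
      unfolding divide_inverse by algebra
    also have "\<dots> = ?M"
      unfolding * unfolding divide_inverse by algebra
    finally show ?thesis .
  qed
  from this[of _ _ "n - _"] show ?thesis
    unfolding vwp_sum_def sum_distrib_left sum_subtractf[symmetric]
    by (intro sum.cong refl) (metis (no_types, lifting) atMost_iff le_add_diff_inverse)
qed

text \<open>
  The terminating 6W5 summation. With \<open>X = t q^j\<close> and \<open>Y = q^m\<close>, the weights \<open>-Y/(X-Y)\<close> and
  \<open>X/(X-Y)\<close> have sum \<open>1\<close> and average \<open>X\<close> and \<open>Y\<close> to \<open>0\<close>. Averaging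
  \<open>(1 - b x / t) (1 - c x / t)\<close> over \<open>x = X, Y\<close> therefore gives a quantity that depends only on
  \<open>X Y = t q^n\<close>, which yields the first-order recursion of \<open>qbin\<close>.
\<close>
lemma terminating_6W5:
  assumes q: "norm q < 1" and t: "t \<noteq> 0" "t \<noteq> 1"
    and nz: "\<And>j m. j + m \<le> n \<Longrightarrow> qpair q t q j m \<noteq> 0 \<and> qpair q t (t * q) j m \<noteq> 0"
  shows "(\<Sum>j\<le>n. (t * q ^ j - q ^ (n - j)) / (t - 1) *
       (qpair q t b j (n - j) * qpair q t c j (n - j) / (qpair q t q j (n - j) * qpair q t (t * q) j (n - j))))
     = qbin q (b * c / t) n"
  using nz
proof (induction n)
  case 0
  then show ?case using t by (simp add: qpair_def)
next
  case (Suc n)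
  define U where "U j m = qpair q t b j m * qpair q t c j m / (qpair q t q j m * qpair q t (t * q) j m)" for j m
  have U1: "U (Suc j) m * ((1 - q ^ Suc j) * (1 - t * q ^ Suc j)) = (1 - b * q ^ j) * (1 - c * q ^ j) * U j m"
    if "Suc j + m \<le> Suc n" for j m
  proof -
    have *: "qpair q t q (Suc j) m = (1 - q ^ Suc j) * qpair q t q j m"
      "qpair q t (t * q) (Suc j) m = (1 - t * q ^ Suc j) * qpair q t (t * q) j m"
      by (simp_all add: qpair_Suc_left mult_ac)
    have "(1 - q ^ Suc j) * qpair q t q j m \<noteq> 0" "(1 - t * q ^ Suc j) * qpair q t (t * q) j m \<noteq> 0"
      using Suc.prems[OF that] unfolding * by blast+
    then show ?thesis
      unfolding U_def * qpair_Suc_left[of q t b] qpair_Suc_left[of q t c] by (simp del: power_Suc)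
  qed
  have U2: "U j (Suc m) * ((1 - q ^ Suc m) * (1 - q ^ Suc m / t)) = (1 - b / t * q ^ m) * (1 - c / t * q ^ m) * U j m"
    if "j + Suc m \<le> Suc n" for j m
  proof -
    have *: "qpair q t q j (Suc m) = (1 - q ^ Suc m / t) * qpair q t q j m"
      "qpair q t (t * q) j (Suc m) = (1 - q ^ Suc m) * qpair q t (t * q) j m"
      using t by (simp_all add: qpair_Suc_right mult_ac)
    have "(1 - q ^ Suc m / t) * qpair q t q j m \<noteq> 0" "(1 - q ^ Suc m) * qpair q t (t * q) j m \<noteq> 0"
      using Suc.prems[OF that] unfolding * by blast+
    then show ?thesis
      unfolding U_def * qpair_Suc_right[of q t b] qpair_Suc_right[of q t c] by (auto simp del: power_Suc)
  qed
  \<comment> \<open>The Vandermonde quotient cancels the denominator \<open>X - Y\<close> of the weights.\<close>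
  define C where "C j m = - (q ^ m / (t - 1)) * (U j m * ((1 - q ^ j) * (1 - t * q ^ j)))" for j m
  define D where "D j m = t * q ^ j / (t - 1) * (U j m * ((1 - q ^ m) * (1 - q ^ m / t)))" for j m
  have CD: "C j m + D j m = (1 - q ^ (j + m)) * ((t * q ^ j - q ^ m) / (t - 1) * U j m)" for j m
    unfolding C_def D_def power_add using t by (simp add: divide_simps) algebra
  have CD': "C (Suc j) (n - j) + D j (Suc (n - j))
      = (1 - b * c / t * q ^ n) * ((t * q ^ j - q ^ (n - j)) / (t - 1) * U j (n - j))" if "j \<le> n" for j
  proof -
    have "q ^ n = q ^ j * q ^ (n - j)"
      using that by (simp flip: power_add)
    moreover have "C (Suc j) m + D j (Suc m) = (1 - b * c / t * (q ^ j * q ^ m)) * ((t * q ^ j - q ^ m) / (t - 1) * U j m)"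
      if "j + m = n" for m
    proof -
      have "C (Suc j) m + D j (Suc m)
          = - (q ^ m / (t - 1)) * ((1 - b * q ^ j) * (1 - c * q ^ j) * U j m)
            + t * q ^ j / (t - 1) * ((1 - b / t * q ^ m) * (1 - c / t * q ^ m) * U j m)"
        unfolding C_def D_def using U1[of j m] U2[of j m] that by simp
      also have "\<dots> = (1 - b * c / t * (q ^ j * q ^ m)) * ((t * q ^ j - q ^ m) / (t - 1) * U j m)"
        using t by (simp add: divide_simps) algebra
      finally show ?thesis .
    qed
    ultimately show ?thesis
      using that by simp
  qed
  have "(1 - q ^ Suc n) * (\<Sum>j\<le>Suc n. (t * q ^ j - q ^ (Suc n - j)) / (t - 1) * U j (Suc n - j))
      = (\<Sum>j\<le>Suc n. C j (Suc n - j) + D j (Suc n - j))"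
    unfolding CD sum_distrib_left by (intro sum.cong) auto
  also have "\<dots> = (\<Sum>j\<le>n. C (Suc j) (n - j) + D j (Suc (n - j)))"
    by (rule antidiagonal_Suc) (auto simp: C_def D_def)
  also have "\<dots> = (1 - b * c / t * q ^ n) * qbin q (b * c / t) n"
  proof -
    have "(\<Sum>j\<le>n. (t * q ^ j - q ^ (n - j)) / (t - 1) * U j (n - j)) = qbin q (b * c / t) n"
      unfolding U_def using Suc.IH Suc.prems by simp
    moreover have "(\<Sum>j\<le>n. C (Suc j) (n - j) + D j (Suc (n - j)))
        = (1 - b * c / t * q ^ n) * (\<Sum>j\<le>n. (t * q ^ j - q ^ (n - j)) / (t - 1) * U j (n - j))"
      unfolding sum_distrib_left by (intro sum.cong refl CD') simp
    ultimately show ?thesis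
      by simp
  qed
  also have "\<dots> = (1 - q ^ Suc n) * qbin q (b * c / t) (Suc n)"
    by (simp only: qbin_Suc[OF q])
  finally show ?case
    using power_Suc_neq_1[OF q, of n] unfolding U_def by (simp del: power_Suc)
qed

section \<open>The dual sums and their contiguous relation\<close>

definition dual_wt :: "complex \<Rightarrow> complex \<Rightarrow> complex \<Rightarrow> complex \<Rightarrow> complex \<Rightarrow> complex \<Rightarrow> nat \<Rightarrow> nat \<Rightarrow> complex" where
  "dual_wt q t d\<^sub>1 d\<^sub>2 a\<^sub>1 a\<^sub>2 j m = (1 / (t * a\<^sub>1 * a\<^sub>2 * q ^ 2)) ^ (j + m) *
     (qfall q a\<^sub>1 d\<^sub>1 j * qfall q a\<^sub>1 d\<^sub>2 j
       / (qpoch q q j * qpoch (a\<^sub>1 / a\<^sub>2 * q) q j * qpoch (a\<^sub>1 * q) q j * qpoch (a\<^sub>1 / t * q) q j)) *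
     (qfall q a\<^sub>2 d\<^sub>1 m * qfall q a\<^sub>2 d\<^sub>2 m
       / (qpoch q q m * qpoch (a\<^sub>2 / a\<^sub>1 * q) q m * qpoch (a\<^sub>2 * q) q m * qpoch (a\<^sub>2 / t * q) q m))"

text \<open>
  Up to a factor this is again a very well-poised sum (see \<open>dual_sum_eq_vwp_sum\<close> below), but
  polynomial in \<open>b\<close> and \<open>c\<close>.
\<close>
definition dual_sum ::
  "complex \<Rightarrow> complex \<Rightarrow> complex \<Rightarrow> complex \<Rightarrow> complex \<Rightarrow> complex \<Rightarrow> complex \<Rightarrow> complex \<Rightarrow> nat \<Rightarrow> complex" where
  "dual_sum q t b c d\<^sub>1 d\<^sub>2 a\<^sub>1 a\<^sub>2 n =
     (\<Sum>j\<le>n. (a\<^sub>1 * q ^ j - a\<^sub>2 * q ^ (n - j)) / (a\<^sub>1 - a\<^sub>2) *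
        dual_wt q t d\<^sub>1 d\<^sub>2 a\<^sub>1 a\<^sub>2 j (n - j) *
        (qfall q a\<^sub>1 b j * qfall q a\<^sub>2 b (n - j) * (qfall q a\<^sub>1 c j * qfall q a\<^sub>2 c (n - j))))"

lemma dual_wt_swap: "dual_wt q t d\<^sub>1 d\<^sub>2 a\<^sub>1 a\<^sub>2 j m = dual_wt q t d\<^sub>1 d\<^sub>2 a\<^sub>2 a\<^sub>1 m j"
  by (simp add: dual_wt_def mult_ac add_ac)

text \<open>
  Each of the four factors on the left cancels the new factor of one denominator.
\<close>
lemma dual_wt_Suc:
  assumes "qpoch q q (Suc j) \<noteq> 0" "qpoch (a\<^sub>1 / a\<^sub>2 * q) q (Suc j) \<noteq> 0"
    and "qpoch (a\<^sub>1 * q) q (Suc j) \<noteq> 0" "qpoch (a\<^sub>1 / t * q) q (Suc j) \<noteq> 0"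
  shows "dual_wt q t d\<^sub>1 d\<^sub>2 a\<^sub>1 a\<^sub>2 (Suc j) m * ((1 - q ^ Suc j) * (1 - a\<^sub>1 / a\<^sub>2 * q ^ Suc j) *
            (1 - a\<^sub>1 * q ^ Suc j) * (1 - a\<^sub>1 / t * q ^ Suc j))
     = 1 / (t * a\<^sub>1 * a\<^sub>2 * q ^ 2) * ((d\<^sub>1 - a\<^sub>1 * q ^ Suc j) * (d\<^sub>2 - a\<^sub>1 * q ^ Suc j)) *
         dual_wt q t d\<^sub>1 d\<^sub>2 a\<^sub>1 a\<^sub>2 j m"
proof -
  have *: "qpoch (a * q) q (Suc j) = qpoch (a * q) q j * (1 - a * q ^ Suc j)" for a
    by (simp add: qpoch_Suc mult_ac)
  have "qpoch q q (Suc j) = qpoch q q j * (1 - q ^ Suc j)"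
    by (simp add: qpoch_Suc)
  note ** = this *
  have nz: "(1 - q ^ Suc j) * (1 - a\<^sub>1 / a\<^sub>2 * q ^ Suc j) * (1 - a\<^sub>1 * q ^ Suc j) *
      (1 - a\<^sub>1 / t * q ^ Suc j) \<noteq> 0"
    using assms unfolding ** mult_eq_0_iff by blast
  have cancel: "k ^ (Suc j + m) * (s * F * (u * G) / (v * A * (w * B) * (x * C) * (y * D))) * M
       * (A * B * C * D) = k * (s * u) * (k ^ (j + m) * (F * G / (v * w * x * y)) * M)"
    if nz: "A * B * C * D \<noteq> 0"
    for k s F u G v w x y M A B C D :: complex
  proof -
    have eq: "v * A * (w * B) * (x * C) * (y * D) = (v * w * x * y) * (A * B * C * D)"
      by algebra
    have "k ^ (Suc j + m) * (s * F * (u * G) / (v * A * (w * B) * (x * C) * (y * D))) * M * (A * B * C * D)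
        = k ^ (Suc j + m) * M * ((s * F * (u * G) * (A * B * C * D)) / ((v * w * x * y) * (A * B * C * D)))"
      unfolding eq by (simp only: times_divide_eq_left times_divide_eq_right mult_ac)
    also have "\<dots> = k ^ (Suc j + m) * M * (s * F * (u * G) / (v * w * x * y))"
      using nz by (simp only: nonzero_mult_divide_mult_cancel_right not_False_eq_True)
    also have "\<dots> = k * (s * u) * (k ^ (j + m) * (F * G / (v * w * x * y)) * M)"
      unfolding divide_inverse add_Suc power_Suc by algebra
    finally show ?thesis .
  qed
  show ?thesis
    unfolding dual_wt_def qfall_Suc ** by (rule cancel[OF nz])
qed

text \<open>
  The contiguous relation of the dual sum does not hold term by term. The defect of the \<open>(j, m)\<close> term
  is a combination of a part with the factor \<open>1 - q^j\<close>, to be matched with \<open>(j - 1, m)\<close>, and a part with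
  \<open>1 - q^m\<close>, to be matched with \<open>(j, m - 1)\<close>. It is a polynomial identity in \<open>x = q^j\<close> and \<open>y = q^m\<close>;
  for \<open>j = 0\<close> or \<open>m = 0\<close> it has to be checked separately because a factor common to all terms is then
  absent.
\<close>
lemma dual_term_contiguous:
  fixes q t b c a\<^sub>1 a\<^sub>2 :: complex
  assumes a: "a\<^sub>1 \<noteq> 0" "a\<^sub>2 \<noteq> 0"
  defines "G \<equiv> \<lambda>p j m. qfall q a\<^sub>1 p j * qfall q a\<^sub>2 p m"
  defines "\<psi>\<^sub>1 \<equiv> \<lambda>j. (1 - q ^ j) * (1 - a\<^sub>1 / a\<^sub>2 * q ^ j) * (1 - a\<^sub>1 * q ^ j) * (1 - a\<^sub>1 / t * q ^ j)"
  defines "\<psi>\<^sub>2 \<equiv> \<lambda>m. (1 - q ^ m) * (1 - a\<^sub>2 / a\<^sub>1 * q ^ m) * (1 - a\<^sub>2 * q ^ m) * (1 - a\<^sub>2 / t * q ^ m)"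
  shows "(a\<^sub>1 * q ^ j - a\<^sub>2 * q ^ m) *
      (c * (1 - b) * (1 - b / t) * (G (b * q) j m * G c j m) - b * (1 - c) * (1 - c / t) * (G b j m * G (c * q) j m)
        - (c - b) * (1 - b * c / t * q ^ (j + m)) * (G b j m * G c j m))
    = (c - b) * b * c *
      ((case j of 0 \<Rightarrow> 0 | Suc i \<Rightarrow> a\<^sub>2 * q ^ m * \<psi>\<^sub>1 j * (G b i m * G c i m))
       - (case m of 0 \<Rightarrow> 0 | Suc i \<Rightarrow> a\<^sub>1 * q ^ j * \<psi>\<^sub>2 m * (G b j i * G c j i)))"
proof -
  define T x y where "T = 1 / t" and "x = q ^ j" and "y = q ^ m"
  have T: "z / t = z * T" for z
    by (simp add: T_def)
  have psi: "a\<^sub>2 * y * \<psi>\<^sub>1 j = y * (1 - x) * (a\<^sub>2 - a\<^sub>1 * x) * (1 - a\<^sub>1 * x) * (1 - a\<^sub>1 * T * x)"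
    "a\<^sub>1 * x * \<psi>\<^sub>2 m = x * (1 - y) * (a\<^sub>1 - a\<^sub>2 * y) * (1 - a\<^sub>2 * y) * (1 - a\<^sub>2 * T * y)"
  proof -
    have *: "a\<^sub>2 * (1 - a\<^sub>1 / a\<^sub>2 * q ^ j) = a\<^sub>2 - a\<^sub>1 * x" "a\<^sub>1 * (1 - a\<^sub>2 / a\<^sub>1 * q ^ m) = a\<^sub>1 - a\<^sub>2 * y"
      using a by (simp_all add: field_simps x_def y_def)
    have "a\<^sub>2 * y * \<psi>\<^sub>1 j = y * (1 - x) * (a\<^sub>2 * (1 - a\<^sub>1 / a\<^sub>2 * q ^ j)) * (1 - a\<^sub>1 * x) * (1 - a\<^sub>1 * T * x)"
      "a\<^sub>1 * x * \<psi>\<^sub>2 m = x * (1 - y) * (a\<^sub>1 * (1 - a\<^sub>2 / a\<^sub>1 * q ^ m)) * (1 - a\<^sub>2 * y) * (1 - a\<^sub>2 * T * y)"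
      unfolding \<psi>\<^sub>1_def \<psi>\<^sub>2_def T x_def y_def by (simp_all only: mult_ac)
    then show "a\<^sub>2 * y * \<psi>\<^sub>1 j = y * (1 - x) * (a\<^sub>2 - a\<^sub>1 * x) * (1 - a\<^sub>1 * x) * (1 - a\<^sub>1 * T * x)"
      "a\<^sub>1 * x * \<psi>\<^sub>2 m = x * (1 - y) * (a\<^sub>1 - a\<^sub>2 * y) * (1 - a\<^sub>2 * y) * (1 - a\<^sub>2 * T * y)"
      unfolding * .
  qed
  show ?thesis
  proof (cases j)
    case 0
    show ?thesis
    proof (cases m)
      case 0
      show ?thesis
        unfolding \<open>j = 0\<close> 0 G_def T qfall_0 nat.case add_0 power_0 by algebra
    next
      case (Suc k)
      have x: "x = 1"
        using \<open>j = 0\<close> by (simp add: x_def)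
      have G: "G p j m = (p - a\<^sub>2 * y) * qfall q a\<^sub>2 p k" "G p j k = qfall q a\<^sub>2 p k" for p
        using \<open>j = 0\<close> by (simp_all only: G_def Suc qfall_Suc y_def qfall_0 mult_1_left)
      have G': "G (p * q) j m = y * ((p - a\<^sub>2) * qfall q a\<^sub>2 p k)" for p
        using \<open>j = 0\<close> by (simp only: G_def Suc qfall_shift y_def qfall_0 mult_1_left)
      show ?thesis
        unfolding power_add x_def[symmetric] y_def[symmetric] G'[of b] G'[of c] G[of b] G[of c] T
        unfolding Suc \<open>j = 0\<close> nat.case G[of b, unfolded Suc \<open>j = 0\<close>] G[of c, unfolded Suc \<open>j = 0\<close>] psi[unfolded Suc \<open>j = 0\<close>] unfolding x by algebra
    qed
  next
    case (Suc i)
    note j = this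
    show ?thesis
    proof (cases m)
      case 0
      have y: "y = 1"
        using 0 by (simp add: y_def)
      have G: "G p j m = (p - a\<^sub>1 * x) * qfall q a\<^sub>1 p i" "G p i m = qfall q a\<^sub>1 p i" for p
        using 0 by (simp_all only: G_def j qfall_Suc x_def qfall_0 mult_1_right)
      have G': "G (p * q) j m = x * ((p - a\<^sub>1) * qfall q a\<^sub>1 p i)" for p
        using 0 by (simp only: G_def j qfall_shift x_def qfall_0 mult_1_right)
      show ?thesis
        unfolding power_add x_def[symmetric] y_def[symmetric] G'[of b] G'[of c] G[of b] G[of c] T
        unfolding 0 j nat.case G[of b, unfolded 0 j] G[of c, unfolded 0 j] psi[unfolded 0 j] unfolding y by algebra
    next
      case (Suc k)
      have G: "G p j m = (p - a\<^sub>1 * x) * qfall q a\<^sub>1 p i * ((p - a\<^sub>2 * y) * qfall q a\<^sub>2 p k)"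
        "G p i m = qfall q a\<^sub>1 p i * ((p - a\<^sub>2 * y) * qfall q a\<^sub>2 p k)"
        "G p j k = (p - a\<^sub>1 * x) * qfall q a\<^sub>1 p i * qfall q a\<^sub>2 p k" for p
        by (simp_all only: G_def j Suc qfall_Suc x_def y_def mult_ac)
      have G': "G (p * q) j m = x * ((p - a\<^sub>1) * qfall q a\<^sub>1 p i) * (y * ((p - a\<^sub>2) * qfall q a\<^sub>2 p k))" for p
        by (simp only: G_def j Suc qfall_shift x_def y_def)
      show ?thesis
        unfolding power_add x_def[symmetric] y_def[symmetric] G'[of b] G'[of c] G[of b] G[of c] T
        unfolding Suc j nat.case G[of b, unfolded Suc j] G[of c, unfolded Suc j] psi[unfolded Suc j] by algebra
    qed
  qed
qed

text \<open>
  Summed over the diagonal, the defects of \<open>dual_term_contiguous\<close> combine on the previous diagonal: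
  with \<open>X = a\<^sub>1 q^(j+1)\<close> and \<open>Y = a\<^sub>2 q^(m+1)\<close>, the weights \<open>-Y/(X-Y)\<close> and \<open>X/(X-Y)\<close> average
  \<open>(d\<^sub>1 - x) (d\<^sub>2 - x)\<close> over \<open>x = X, Y\<close> to \<open>d\<^sub>1 d\<^sub>2 - X Y\<close>, which depends only on \<open>j + m\<close>.
\<close>
lemma dual_sum_contiguous:
  fixes q t b c d\<^sub>1 d\<^sub>2 a\<^sub>1 a\<^sub>2 :: complex
  assumes q: "q \<noteq> 0" "norm q < 1" and t: "t \<noteq> 0" and a: "a\<^sub>1 \<noteq> 0" "a\<^sub>2 \<noteq> 0" "a\<^sub>1 \<noteq> a\<^sub>2"
    and nz1: "qpoch (a\<^sub>1 / a\<^sub>2 * q) q n \<noteq> 0" "qpoch (a\<^sub>1 * q) q n \<noteq> 0" "qpoch (a\<^sub>1 / t * q) q n \<noteq> 0"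
    and nz2: "qpoch (a\<^sub>2 / a\<^sub>1 * q) q n \<noteq> 0" "qpoch (a\<^sub>2 * q) q n \<noteq> 0" "qpoch (a\<^sub>2 / t * q) q n \<noteq> 0"
  shows "c * (1 - b) * (1 - b / t) * dual_sum q t (b * q) c d\<^sub>1 d\<^sub>2 a\<^sub>1 a\<^sub>2 n
       - b * (1 - c) * (1 - c / t) * dual_sum q t b (c * q) d\<^sub>1 d\<^sub>2 a\<^sub>1 a\<^sub>2 n
     = (c - b) * ((1 - b * c / t * q ^ n) * dual_sum q t b c d\<^sub>1 d\<^sub>2 a\<^sub>1 a\<^sub>2 n
         - (case n of 0 \<Rightarrow> 0 | Suc k \<Rightarrow>
             (b * c * d\<^sub>1 * d\<^sub>2 / (t * a\<^sub>1 * a\<^sub>2 * q ^ 2) - b * c / t * q ^ k) * dual_sum q t b c d\<^sub>1 d\<^sub>2 a\<^sub>1 a\<^sub>2 k))"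
proof (cases n)
  case 0
  have "c * (1 - b) * (1 - b / t) - b * (1 - c) * (1 - c / t) = (c - b) * (1 - b * c / t)"
    unfolding divide_inverse by algebra
  then show ?thesis
    using 0 a by (simp add: dual_sum_def dual_wt_def)
next
  case (Suc k)
  define G where "G p j m = qfall q a\<^sub>1 p j * qfall q a\<^sub>2 p m" for p j m
  define \<psi>\<^sub>1 where "\<psi>\<^sub>1 j = (1 - q ^ j) * (1 - a\<^sub>1 / a\<^sub>2 * q ^ j) * (1 - a\<^sub>1 * q ^ j) * (1 - a\<^sub>1 / t * q ^ j)" for j
  define \<psi>\<^sub>2 where "\<psi>\<^sub>2 m = (1 - q ^ m) * (1 - a\<^sub>2 / a\<^sub>1 * q ^ m) * (1 - a\<^sub>2 * q ^ m) * (1 - a\<^sub>2 / t * q ^ m)" for m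
  define w where "w j m = dual_wt q t d\<^sub>1 d\<^sub>2 a\<^sub>1 a\<^sub>2 j m" for j m
  define S where "S b c j m = (a\<^sub>1 * q ^ j - a\<^sub>2 * q ^ m) / (a\<^sub>1 - a\<^sub>2) * w j m * (G b j m * G c j m)" for b c j m
  have S: "dual_sum q t b c d\<^sub>1 d\<^sub>2 a\<^sub>1 a\<^sub>2 n = (\<Sum>j\<le>n. S b c j (n - j))" for b c n
    unfolding dual_sum_def S_def w_def G_def ..
  define C where "C j m = (case j of 0 \<Rightarrow> 0 | Suc i \<Rightarrow>
    - (a\<^sub>2 * q ^ m / (a\<^sub>1 - a\<^sub>2)) * (w j m * \<psi>\<^sub>1 j) * (b * c * (G b i m * G c i m)))" for j m
  define D where "D j m = (case m of 0 \<Rightarrow> 0 | Suc i \<Rightarrow>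
    a\<^sub>1 * q ^ j / (a\<^sub>1 - a\<^sub>2) * (w j m * \<psi>\<^sub>2 m) * (b * c * (G b j i * G c j i)))" for j m
  have termwise: "c * (1 - b) * (1 - b / t) * S (b * q) c j m - b * (1 - c) * (1 - c / t) * S b (c * q) j m
      = (c - b) * (1 - b * c / t * q ^ (j + m)) * S b c j m - (c - b) * (C j m + D j m)" for j m
  proof -
    define X where "X = (case j of 0 \<Rightarrow> 0 | Suc i \<Rightarrow> a\<^sub>2 * q ^ m * \<psi>\<^sub>1 j * (G b i m * G c i m))"
    define Y where "Y = (case m of 0 \<Rightarrow> 0 | Suc i \<Rightarrow> a\<^sub>1 * q ^ j * \<psi>\<^sub>2 m * (G b j i * G c j i))"
    define W where "W = w j m / (a\<^sub>1 - a\<^sub>2)"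
    have core: "(a\<^sub>1 * q ^ j - a\<^sub>2 * q ^ m) *
      (c * (1 - b) * (1 - b / t) * (G (b * q) j m * G c j m) - b * (1 - c) * (1 - c / t) * (G b j m * G (c * q) j m)
        - (c - b) * (1 - b * c / t * q ^ (j + m)) * (G b j m * G c j m)) = (c - b) * b * c * (X - Y)" (is "?l = _")
      unfolding X_def Y_def G_def \<psi>\<^sub>1_def \<psi>\<^sub>2_def by (rule dual_term_contiguous[OF a(1,2)])
    have CD: "C j m = - (b * c * W * X)" "D j m = b * c * W * Y"
      by (simp_all add: C_def D_def X_def Y_def W_def split: nat.split)
    have "c * (1 - b) * (1 - b / t) * S (b * q) c j m - b * (1 - c) * (1 - c / t) * S b (c * q) j m
      - (c - b) * (1 - b * c / t * q ^ (j + m)) * S b c j m = W * ?l"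
      unfolding S_def W_def divide_inverse by algebra
    also have "\<dots> = - ((c - b) * (C j m + D j m))"
      unfolding core CD by algebra
    finally have "c * (1 - b) * (1 - b / t) * S (b * q) c j m - b * (1 - c) * (1 - c / t) * S b (c * q) j m
      = - ((c - b) * (C j m + D j m)) + (c - b) * (1 - b * c / t * q ^ (j + m)) * S b c j m"
      by (simp only: diff_eq_eq)
    then show ?thesis
      by (simp only: add.commute diff_conv_add_uminus)
  qed
  have qk: "qpoch x q n \<noteq> 0 \<Longrightarrow> j \<le> k \<Longrightarrow> qpoch x q (Suc j) \<noteq> 0" for x j
    using qpoch_nonzero_mono[of x q n "Suc j"] Suc by simp
  note nz = qk[OF qpoch_qq_nonzero[OF q(2)]] nz1[THEN qk] nz2[THEN qk]
  have weights: "C (Suc j) m + D j (Suc m)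
      = (b * c * d\<^sub>1 * d\<^sub>2 / (t * a\<^sub>1 * a\<^sub>2 * q ^ 2) - b * c / t * q ^ k) * S b c j m" if "j + m = k" for j m
  proof -
    define \<kappa> where "\<kappa> = 1 / (t * a\<^sub>1 * a\<^sub>2 * q ^ 2)"
    have 1: "w (Suc j) m * \<psi>\<^sub>1 (Suc j) = \<kappa> * ((d\<^sub>1 - a\<^sub>1 * q ^ Suc j) * (d\<^sub>2 - a\<^sub>1 * q ^ Suc j)) * w j m"
      unfolding w_def \<psi>\<^sub>1_def \<kappa>_def using that by (intro dual_wt_Suc nz) auto
    have "w j (Suc m) * \<psi>\<^sub>2 (Suc m) = 1 / (t * a\<^sub>2 * a\<^sub>1 * q ^ 2) * ((d\<^sub>1 - a\<^sub>2 * q ^ Suc m) * (d\<^sub>2 - a\<^sub>2 * q ^ Suc m)) * w j m"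
      unfolding w_def \<psi>\<^sub>2_def dual_wt_swap[of q t d\<^sub>1 d\<^sub>2 a\<^sub>1 a\<^sub>2 j] using that by (intro dual_wt_Suc nz) auto
    then have 2: "w j (Suc m) * \<psi>\<^sub>2 (Suc m) = \<kappa> * ((d\<^sub>1 - a\<^sub>2 * q ^ Suc m) * (d\<^sub>2 - a\<^sub>2 * q ^ Suc m)) * w j m"
      unfolding \<kappa>_def by (simp only: mult_ac)
    have 3: "b * c / t * q ^ k = b * c * \<kappa> * (a\<^sub>1 * a\<^sub>2 * q ^ Suc j * q ^ Suc m)"
      using that[symmetric] q t a by (simp add: \<kappa>_def power_add power2_eq_square)
    have 4: "b * c * d\<^sub>1 * d\<^sub>2 / (t * a\<^sub>1 * a\<^sub>2 * q ^ 2) = b * c * d\<^sub>1 * d\<^sub>2 * \<kappa>"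
      by (simp add: \<kappa>_def)
    have "C (Suc j) m + D j (Suc m)
       = b * c * (G b j m * G c j m) * w j m * \<kappa> / (a\<^sub>1 - a\<^sub>2) *
          (a\<^sub>1 * q ^ j * ((d\<^sub>1 - a\<^sub>2 * q ^ Suc m) * (d\<^sub>2 - a\<^sub>2 * q ^ Suc m))
           - a\<^sub>2 * q ^ m * ((d\<^sub>1 - a\<^sub>1 * q ^ Suc j) * (d\<^sub>2 - a\<^sub>1 * q ^ Suc j)))"
      unfolding C_def D_def nat.case 1 2 divide_inverse by algebra
    also have "\<dots> = (b * c * d\<^sub>1 * d\<^sub>2 * \<kappa> - b * c * \<kappa> * (a\<^sub>1 * a\<^sub>2 * q ^ Suc j * q ^ Suc m)) * S b c j m"
      unfolding S_def divide_inverse power_Suc by algebra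
    finally show ?thesis
      unfolding 3 4 .
  qed
  have "(\<Sum>j\<le>Suc k. C j (Suc k - j) + D j (Suc k - j)) = (\<Sum>j\<le>k. C (Suc j) (k - j) + D j (Suc (k - j)))"
    by (rule antidiagonal_Suc) (auto simp: C_def D_def)
  also have "\<dots> = (b * c * d\<^sub>1 * d\<^sub>2 / (t * a\<^sub>1 * a\<^sub>2 * q ^ 2) - b * c / t * q ^ k) * (\<Sum>j\<le>k. S b c j (k - j))"
    unfolding sum_distrib_left by (intro sum.cong refl weights) simp
  finally have CD: "(\<Sum>j\<le>n. C j (n - j) + D j (n - j))
      = (b * c * d\<^sub>1 * d\<^sub>2 / (t * a\<^sub>1 * a\<^sub>2 * q ^ 2) - b * c / t * q ^ k) * (\<Sum>j\<le>k. S b c j (k - j))"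
    unfolding Suc .
  have "(\<Sum>j\<le>n. c * (1 - b) * (1 - b / t) * S (b * q) c j (n - j) - b * (1 - c) * (1 - c / t) * S b (c * q) j (n - j))
      = (\<Sum>j\<le>n. (c - b) * (1 - b * c / t * q ^ n) * S b c j (n - j) - (c - b) * (C j (n - j) + D j (n - j)))"
    unfolding termwise by (intro sum.cong) auto
  then have "c * (1 - b) * (1 - b / t) * (\<Sum>j\<le>n. S (b * q) c j (n - j)) - b * (1 - c) * (1 - c / t) * (\<Sum>j\<le>n. S b (c * q) j (n - j))
      = (c - b) * (1 - b * c / t * q ^ n) * (\<Sum>j\<le>n. S b c j (n - j)) - (c - b) * (\<Sum>j\<le>n. C j (n - j) + D j (n - j))"
    by (simp only: sum_subtractf sum_distrib_left)
  moreover have "u * v * x - u * (y * z) = u * (v * x - y * z)" for u v x y z :: complex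
    by algebra
  ultimately show ?thesis
    unfolding S CD unfolding Suc nat.case by metis
qed

text \<open>
  The coefficient of \<open>u^n\<close> in \<open>(A u)_\<infinity> / (u)_\<infinity>\<close> times the generating function of the dual sums.
\<close>
definition euler_sum ::
  "complex \<Rightarrow> complex \<Rightarrow> complex \<Rightarrow> complex \<Rightarrow> complex \<Rightarrow> complex \<Rightarrow> complex \<Rightarrow> complex \<Rightarrow> nat \<Rightarrow> complex" where
  "euler_sum q t b c d\<^sub>1 d\<^sub>2 a\<^sub>1 a\<^sub>2 n =
     (\<Sum>l\<le>n. qbin q (b * c * d\<^sub>1 * d\<^sub>2 / (t * a\<^sub>1 * a\<^sub>2 * q ^ 2)) (n - l) * dual_sum q t b c d\<^sub>1 d\<^sub>2 a\<^sub>1 a\<^sub>2 l)"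

text \<open>
  A shift of \<open>b\<close> or \<open>c\<close> replaces \<open>A\<close> by \<open>A q\<close>, and multiplication by \<open>q^n\<close> replaces \<open>u\<close> by \<open>q u\<close>.
  Relative to the common factor \<open>(A q u)_\<infinity> / (u)_\<infinity>\<close> this costs \<open>1 - A u\<close> and \<open>1 - u\<close>; these two
  factors produce precisely the terms of \<open>dual_sum_contiguous\<close> with lowered index.
\<close>
lemma euler_sum_contiguous:
  fixes q t b c d\<^sub>1 d\<^sub>2 a\<^sub>1 a\<^sub>2 :: complex
  assumes q: "q \<noteq> 0" "norm q < 1" and t: "t \<noteq> 0" and a: "a\<^sub>1 \<noteq> 0" "a\<^sub>2 \<noteq> 0" "a\<^sub>1 \<noteq> a\<^sub>2"
    and nz1: "qpoch (a\<^sub>1 / a\<^sub>2 * q) q n \<noteq> 0" "qpoch (a\<^sub>1 * q) q n \<noteq> 0" "qpoch (a\<^sub>1 / t * q) q n \<noteq> 0"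
    and nz2: "qpoch (a\<^sub>2 / a\<^sub>1 * q) q n \<noteq> 0" "qpoch (a\<^sub>2 * q) q n \<noteq> 0" "qpoch (a\<^sub>2 / t * q) q n \<noteq> 0"
  shows "c * (1 - b) * (1 - b / t) * euler_sum q t (b * q) c d\<^sub>1 d\<^sub>2 a\<^sub>1 a\<^sub>2 n
       - b * (1 - c) * (1 - c / t) * euler_sum q t b (c * q) d\<^sub>1 d\<^sub>2 a\<^sub>1 a\<^sub>2 n
     = (c - b) * (1 - b * c / t * q ^ n) * euler_sum q t b c d\<^sub>1 d\<^sub>2 a\<^sub>1 a\<^sub>2 n"
proof -
  define A where "A = b * c * d\<^sub>1 * d\<^sub>2 / (t * a\<^sub>1 * a\<^sub>2 * q ^ 2)"
  define T where "T b c l = dual_sum q t b c d\<^sub>1 d\<^sub>2 a\<^sub>1 a\<^sub>2 l" for b c l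
  define pre where "pre F l = (case l of 0 \<Rightarrow> 0 | Suc k \<Rightarrow> F k)" for F :: "nat \<Rightarrow> complex" and l
  have A: "b * q * c * d\<^sub>1 * d\<^sub>2 / (t * a\<^sub>1 * a\<^sub>2 * q ^ 2) = A * q" "b * (c * q) * d\<^sub>1 * d\<^sub>2 / (t * a\<^sub>1 * a\<^sub>2 * q ^ 2) = A * q"
    by (simp_all add: A_def)
  have T: "c * (1 - b) * (1 - b / t) * T (b * q) c l - b * (1 - c) * (1 - c / t) * T b (c * q) l
     = (c - b) * ((T b c l - A * pre (T b c) l) - b * c / t * (q ^ l * T b c l - 1 * pre (\<lambda>l. q ^ l * T b c l) l))"
    if "l \<le> n" for l
  proof -
    have "c * (1 - b) * (1 - b / t) * T (b * q) c l - b * (1 - c) * (1 - c / t) * T b (c * q) l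
      = (c - b) * ((1 - b * c / t * q ^ l) * T b c l - (case l of 0 \<Rightarrow> 0 | Suc k \<Rightarrow> (A - b * c / t * q ^ k) * T b c k))"
      unfolding A_def T_def
      by (intro dual_sum_contiguous assms qpoch_nonzero_mono[OF _ that])
    also have "(case l of 0 \<Rightarrow> 0 | Suc k \<Rightarrow> (A - b * c / t * q ^ k) * T b c k) = A * pre (T b c) l - b * c / t * pre (\<lambda>l. q ^ l * T b c l) l"
      by (simp add: pre_def ring_distribs split: nat.split)
    finally show ?thesis
      by (simp add: algebra_simps)
  qed
  have 1: "(\<Sum>l\<le>n. qbin q A (n - l) * T b c l) = (\<Sum>l\<le>n. qbin q (A * q) (n - l) * (T b c l - A * pre (T b c) l))"
    unfolding pre_def by (rule convolution_difference) (simp, rule qbin_shift[OF q(2)])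
  have "q ^ n * (\<Sum>l\<le>n. qbin q A (n - l) * T b c l) = (\<Sum>l\<le>n. (q ^ (n - l) * qbin q A (n - l)) * (q ^ l * T b c l))"
    unfolding sum_distrib_left
  proof (intro sum.cong refl)
    fix l assume "l \<in> {..n}"
    then have "q ^ n = q ^ (n - l) * q ^ l"
      by (simp flip: power_add)
    then show "q ^ n * (qbin q A (n - l) * T b c l) = q ^ (n - l) * qbin q A (n - l) * (q ^ l * T b c l)"
      by (simp only: mult_ac)
  qed
  also have "\<dots> = (\<Sum>l\<le>n. qbin q (A * q) (n - l) * (q ^ l * T b c l - 1 * pre (\<lambda>l. q ^ l * T b c l) l))"
    unfolding pre_def by (rule convolution_difference) (simp, simp only: qbin_shift'[OF q(2)] mult_1_left)
  finally have 2: "q ^ n * (\<Sum>l\<le>n. qbin q A (n - l) * T b c l)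
     = (\<Sum>l\<le>n. qbin q (A * q) (n - l) * (q ^ l * T b c l - 1 * pre (\<lambda>l. q ^ l * T b c l) l))" .
  have "c * (1 - b) * (1 - b / t) * (\<Sum>l\<le>n. qbin q (A * q) (n - l) * T (b * q) c l)
       - b * (1 - c) * (1 - c / t) * (\<Sum>l\<le>n. qbin q (A * q) (n - l) * T b (c * q) l)
     = (\<Sum>l\<le>n. qbin q (A * q) (n - l) * (c * (1 - b) * (1 - b / t) * T (b * q) c l - b * (1 - c) * (1 - c / t) * T b (c * q) l))"
    unfolding sum_distrib_left sum_subtractf[symmetric] by (intro sum.cong) (simp_all add: algebra_simps)
  also have "\<dots> = (\<Sum>l\<le>n. qbin q (A * q) (n - l) * ((c - b) * ((T b c l - A * pre (T b c) l) - b * c / t * (q ^ l * T b c l - 1 * pre (\<lambda>l. q ^ l * T b c l) l))))"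
    by (intro sum.cong refl arg_cong2[of _ _ _ _ "(*)"] T) simp
  also have "\<dots> = (c - b) * ((\<Sum>l\<le>n. qbin q (A * q) (n - l) * (T b c l - A * pre (T b c) l))
       - b * c / t * (\<Sum>l\<le>n. qbin q (A * q) (n - l) * (q ^ l * T b c l - 1 * pre (\<lambda>l. q ^ l * T b c l) l)))"
    unfolding sum_distrib_left sum_subtractf[symmetric] by (intro sum.cong) (simp_all add: algebra_simps)
  also have "\<dots> = (c - b) * (1 - b * c / t * q ^ n) * (\<Sum>l\<le>n. qbin q A (n - l) * T b c l)"
    unfolding 1[symmetric] 2[symmetric] by algebra
  finally show ?thesis
    unfolding euler_sum_def A T_def A_def .
qed

section \<open>Polynomial solutions of the contiguous relation\<close>

definition poly_deg :: "nat \<Rightarrow> (complex \<Rightarrow> complex) \<Rightarrow> bool" where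
  "poly_deg n F \<longleftrightarrow> (\<exists>p. degree p \<le> n \<and> F = poly p)"

lemma poly_deg_const: "poly_deg n (\<lambda>_. c)"
  unfolding poly_deg_def by (intro exI[of _ "[:c:]"]) auto

lemma poly_deg_linear: "poly_deg (Suc 0) (\<lambda>x. a + b * x)"
  unfolding poly_deg_def by (intro exI[of _ "[:a, b:]"]) (auto simp: mult_ac)

lemma poly_deg_mult: "poly_deg m F \<Longrightarrow> poly_deg n G \<Longrightarrow> poly_deg (m + n) (\<lambda>x. F x * G x)"
  unfolding poly_deg_def
proof (elim exE conjE)
  fix p r assume "degree p \<le> m" "F = poly p" "degree r \<le> n" "G = poly r"
  then show "\<exists>p. degree p \<le> m + n \<and> (\<lambda>x. F x * G x) = poly p"
    by (intro exI[of _ "p * r"]) (auto intro: order.trans[OF degree_mult_le])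
qed

lemma poly_deg_cmult: "poly_deg n F \<Longrightarrow> poly_deg n (\<lambda>x. c * F x)"
  using poly_deg_mult[OF poly_deg_const[of 0 c]] by simp

lemma poly_deg_diff: "poly_deg n F \<Longrightarrow> poly_deg n G \<Longrightarrow> poly_deg n (\<lambda>x. F x - G x)"
  unfolding poly_deg_def
proof (elim exE conjE)
  fix p r assume "degree p \<le> n" "F = poly p" "degree r \<le> n" "G = poly r"
  then show "\<exists>p. degree p \<le> n \<and> (\<lambda>x. F x - G x) = poly p"
    by (intro exI[of _ "p - r"]) (auto intro: degree_diff_le)
qed

lemma poly_deg_sum:
  assumes "finite I" and "\<And>i. i \<in> I \<Longrightarrow> poly_deg n (F i)"
  shows "poly_deg n (\<lambda>x. \<Sum>i\<in>I. F i x)"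
proof -
  from assms(2) obtain p where p: "\<And>i. i \<in> I \<Longrightarrow> degree (p i) \<le> n \<and> F i = poly (p i)"
    unfolding poly_deg_def by metis
  then show ?thesis
    unfolding poly_deg_def
    by (intro exI[of _ "\<Sum>i\<in>I. p i"] conjI) (auto intro!: degree_sum_le assms(1) simp: poly_sum fun_eq_iff)
qed

lemma poly_deg_prod:
  assumes "\<And>i. i < n \<Longrightarrow> poly_deg (Suc 0) (F i)"
  shows "poly_deg n (\<lambda>x. \<Prod>i<n. F i x)"
  using assms
proof (induction n)
  case 0
  then show ?case by (simp add: poly_deg_const)
next
  case (Suc n)
  then have "poly_deg (n + Suc 0) (\<lambda>x. (\<Prod>i<n. F i x) * F n x)"
    by (intro poly_deg_mult) auto
  then show ?case by simp
qed

lemma poly_deg_eqI: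
  assumes "poly_deg m F" "poly_deg n G" and "infinite S" and "\<And>x. x \<in> S \<Longrightarrow> F x = G x"
  shows "F = G"
proof -
  from assms obtain p r where p: "F = poly p" "G = poly r"
    unfolding poly_deg_def by blast
  have "S \<subseteq> {x. poly (p - r) x = 0}"
    using assms(4) p by auto
  then have "infinite {x. poly (p - r) x = 0}"
    using assms(3) finite_subset by blast
  then have "p - r = 0"
    using poly_roots_finite by blast
  then show ?thesis
    using p by simp
qed

lemma poly_deg_qpoch: "poly_deg n (\<lambda>x. qpoch (x * k) q n)"
proof -
  have "poly_deg (Suc 0) (\<lambda>x. 1 - x * k * q ^ i)" for i
    using poly_deg_linear[of 1 "- (k * q ^ i)"] by (simp add: mult_ac)
  then show ?thesis
    unfolding qpoch_def by (intro poly_deg_prod) auto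
qed

text \<open>
  By induction on \<open>s\<close>, \<open>D(q^(-s), c) = 0\<close> for all \<open>c\<close>: in the relation at \<open>b = q^(-s)\<close> the term
  \<open>D(bq, c)\<close> drops out, for \<open>s = 0\<close> because of its factor \<open>1 - b\<close>. What is left is
  \<open>(1 - c) (1 - c/t) P(cq) = (1 - c q^s) (1 - c q^(n-s) / t) P(c)\<close>, which \<open>Q(c) = (c)_s (c/t)_(n-s)\<close>
  satisfies too. So \<open>P/Q\<close> is invariant under \<open>c \<mapsto> cq\<close>, hence constant near \<open>0\<close> by continuity, and the
  zero \<open>x\<close> of \<open>P\<close>, at which \<open>Q\<close> does not vanish, makes the constant \<open>0\<close>. Then \<open>D\<close> has \<open>n + 1\<close> zeros in \<open>b\<close>.
\<close>
lemma contiguous_eq_0: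
  fixes D :: "complex \<Rightarrow> complex \<Rightarrow> complex" and q t x :: complex
  assumes q: "q \<noteq> 0" "norm q < 1" and t: "t \<noteq> 0"
    and deg: "\<And>c. poly_deg n (\<lambda>b. D b c)" "\<And>b. poly_deg n (D b)"
    and contiguous: "\<And>b c. c * (1 - b) * (1 - b / t) * D (b * q) c - b * (1 - c) * (1 - c / t) * D b (c * q)
        = (c - b) * (1 - b * c / t * q ^ n) * D b c"
    and x: "\<And>b. D b x = 0" "qpoch x q n \<noteq> 0" "qpoch (x / t) q n \<noteq> 0"
  shows "D b c = 0"
proof -
  have step: "D (1 / q ^ s) c = 0"
    if s: "s \<le> n" and prev: "\<And>c. (1 - 1 / q ^ s) * D (1 / q ^ s * q) c = 0" for s c
  proof -
    define P where "P = D (1 / q ^ s)"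
    define Q where "Q c = qpoch c q s * qpoch (c / t) q (n - s)" for c
    have P: "(1 - c) * (1 - c / t) * P (c * q) = (1 - c * q ^ s) * (1 - c / t * q ^ (n - s)) * P c" for c
    proof -
      let ?b = "1 / q ^ s"
      have n: "?b * q ^ n = q ^ (n - s)"
        using s q by (simp add: power_diff)
      have "- (?b * ((1 - c) * (1 - c / t) * P (c * q)))
          = c * (1 - ?b / t) * ((1 - ?b) * D (?b * q) c) - ?b * (1 - c) * (1 - c / t) * D ?b (c * q)"
        unfolding prev P_def by (simp add: mult_ac)
      also have "\<dots> = c * (1 - ?b) * (1 - ?b / t) * D (?b * q) c - ?b * (1 - c) * (1 - c / t) * D ?b (c * q)"
        by (simp only: mult_ac)
      also have "\<dots> = (c - ?b) * (1 - c / t * (?b * q ^ n)) * P c"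
        unfolding contiguous P_def by (simp add: mult_ac)
      also have "\<dots> = - (?b * ((1 - c * q ^ s) * (1 - c / t * q ^ (n - s)) * P c))"
      proof -
        have "c - ?b = - (?b * (1 - c * q ^ s))"
          using q by (simp add: field_simps)
        then show ?thesis
          unfolding n by (simp add: mult_ac)
      qed
      finally show ?thesis
        using q by simp
    qed
    have Q: "(1 - c) * (1 - c / t) * Q (c * q) = (1 - c * q ^ s) * (1 - c / t * q ^ (n - s)) * Q c" for c
    proof -
      have "(1 - c) * (1 - c / t) * Q (c * q)
          = ((1 - c) * qpoch (c * q) q s) * ((1 - c / t) * qpoch (c / t * q) q (n - s))"
        by (simp add: Q_def mult_ac)
      also have "\<dots> = (1 - c * q ^ s) * (1 - c / t * q ^ (n - s)) * Q c"
        unfolding qpoch_shift by (simp only: Q_def mult_ac)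
      finally show ?thesis .
    qed
    \<comment> \<open>Inside this disc \<open>Q\<close> has no zero along the orbit \<open>z q^k\<close>.\<close>
    define r where "r = min 1 (norm t)"
    have r: "r > 0" "r \<le> 1" "r \<le> norm t"
      using t by (auto simp: r_def)
    have Q_nz: "Q z \<noteq> 0" if "norm z < r" for z
    proof -
      have "norm (z * q ^ i) < r" for i
      proof -
        have "norm (z * q ^ i) \<le> norm z * 1"
          unfolding norm_mult norm_power using q by (intro mult_left_mono power_le_one) auto
        then show ?thesis using that by simp
      qed
      then have "z * q ^ i \<noteq> 1" "z * q ^ i \<noteq> t" for i
        using r by (metis norm_one not_less, metis not_less)
      then show ?thesis
        using t unfolding Q_def by (auto simp: qpoch_eq_0_iff field_simps)
    qed
    have disc: "norm (z * q) < r" if "norm z < r" for z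
    proof -
      have "norm (z * q) \<le> norm z * 1"
        unfolding norm_mult using q by (intro mult_left_mono) auto
      then show ?thesis using that by simp
    qed
    have ratio_q: "P (z * q) / Q (z * q) = P z / Q z" if "norm z < r" for z
    proof -
      have "z \<noteq> 1" "z \<noteq> t"
        using that r by auto
      then have nz: "(1 - z) * (1 - z / t) \<noteq> 0"
        using t by simp
      have "((1 - z) * (1 - z / t)) * (P (z * q) * Q z) = ((1 - z) * (1 - z / t)) * (P z * Q (z * q))"
      proof -
        have "(1 - z) * (1 - z / t) * P (z * q) * Q z = P z * ((1 - z) * (1 - z / t) * Q (z * q))"
          unfolding P Q by (simp only: mult_ac)
        then show ?thesis
          by (simp only: mult_ac)
      qed
      then have "P (z * q) * Q z = P z * Q (z * q)"
        by (simp only: mult_left_cancel[OF nz])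
      then show ?thesis
        using Q_nz[OF that] Q_nz[OF disc[OF that]] by (simp add: field_simps)
    qed
    have disc_k: "norm (z * q ^ k) < r" if "norm z < r" for z k
    proof (induction k)
      case (Suc k)
      then show ?case
        using disc[of "z * q ^ k"] by (simp add: mult_ac)
    qed (use that in simp)
    have ratio: "P (z * q ^ k) / Q (z * q ^ k) = P z / Q z" if "norm z < r" for z k
    proof (induction k)
      case (Suc k)
      then show ?case
        using ratio_q[OF disc_k[OF that, of k]] by (simp add: mult_ac)
    qed simp
    obtain p where p: "P = poly p"
      using deg(2)[of "1 / q ^ s"] by (auto simp: poly_deg_def P_def)
    have Q_deg: "poly_deg (s + (n - s)) Q"
      unfolding Q_def using poly_deg_mult[OF poly_deg_qpoch[of s 1 q] poly_deg_qpoch[of "n - s" "1 / t" q]] by simp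
    then obtain u where u: "Q = poly u"
      by (auto simp: poly_deg_def)
    have Q0: "Q 0 = 1"
      by (simp add: Q_def qpoch_def)
    have small: "P z = P 0 * Q z" if "norm z < r" for z
    proof -
      have "(\<lambda>k. q ^ k) \<longlonglongrightarrow> 0"
        using q(2) by (rule LIMSEQ_power_zero)
      then have lim0: "(\<lambda>k. z * q ^ k) \<longlonglongrightarrow> 0"
        by (rule tendsto_mult_right_zero)
      have "isCont (\<lambda>x. P x / Q x) 0"
        unfolding p u using Q0 u by (intro continuous_intros) auto
      from isCont_tendsto_compose[OF this lim0]
      have "(\<lambda>k. P z / Q z) \<longlonglongrightarrow> P 0 / Q 0"
        unfolding ratio[OF that] .
      then have "P z / Q z = P 0"
        using LIMSEQ_unique[OF tendsto_const] by (fastforce simp: Q0)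
      then show ?thesis
        using Q_nz[OF that] by (simp add: field_simps)
    qed
    have "P = (\<lambda>z. P 0 * Q z)"
    proof (rule poly_deg_eqI)
      show "poly_deg n P"
        unfolding P_def by (rule deg)
      show "poly_deg (s + (n - s)) (\<lambda>z. P 0 * Q z)"
        by (rule poly_deg_cmult[OF Q_deg])
      show "infinite (range (\<lambda>k::nat. complex_of_real (r / (2 + real k))))"
        using r by (intro range_inj_infinite injI) (auto simp: field_simps)
      show "P z = P 0 * Q z" if "z \<in> range (\<lambda>k::nat. complex_of_real (r / (2 + real k)))" for z
      proof (rule small)
        from that obtain k :: nat where z: "z = complex_of_real (r / (2 + real k))"
          by blast
        have "r / (2 + real k) < r"
          using r by (simp add: field_simps add_pos_nonneg)
        then show "norm z < r"
          unfolding z norm_of_real using r by simp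
      qed
    qed
    then have *: "P z = P 0 * Q z" for z
      by metis
    have "Q x \<noteq> 0"
      unfolding Q_def using x(2,3) s qpoch_nonzero_mono[of _ q n] by simp
    then have "P 0 = 0"
      using *[of x] x(1)[of "1 / q ^ s"] by (simp add: P_def)
    then show ?thesis
      using *[of c] by (simp add: P_def)
  qed
  have node: "\<forall>c. D (1 / q ^ s) c = 0" if "s \<le> n" for s
    using that
  proof (induction s)
    case 0
    show ?case
      by (intro allI step) auto
  next
    case (Suc s)
    moreover have "1 / q ^ Suc s * q = 1 / q ^ s"
      using q by simp
    ultimately show ?case
      by (intro allI step) auto
  qed
  have inj: "inj_on (\<lambda>s. 1 / q ^ s) {..n}"
  proof (rule inj_onI)
    fix i j
    assume "1 / q ^ i = 1 / q ^ j"
    then have "norm q ^ i = norm q ^ j"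
      using q by (simp flip: norm_power)
    then show "i = j"
      using q by (metis less_le norm_ge_zero norm_eq_zero power_inject_exp')
  qed
  obtain p where p: "degree p \<le> n" "(\<lambda>b. D b c) = poly p"
    using deg(1)[of c] by (auto simp: poly_deg_def)
  have p': "D b c = poly p b" for b
    using p(2) by (rule fun_cong)
  have "p = 0"
  proof (rule ccontr)
    assume "p \<noteq> 0"
    have "(\<lambda>s. 1 / q ^ s) ` {..n} \<subseteq> {z. poly p z = 0}"
      using node by (auto simp flip: p')
    then have "card {..n} \<le> card {z. poly p z = 0}"
      unfolding card_image[OF inj, symmetric] by (intro card_mono poly_roots_finite \<open>p \<noteq> 0\<close>)
    also have "\<dots> \<le> n"
      using card_poly_roots_bound[OF \<open>p \<noteq> 0\<close>] p(1) by simp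
    finally show False
      by simp
  qed
  then show ?thesis
    by (simp add: p')
qed

lemma poly_deg_qpair: "poly_deg (j + m) (\<lambda>x. qpair q t x j m)"
  unfolding qpair_def using poly_deg_mult[OF poly_deg_qpoch[of j 1 q] poly_deg_qpoch[of m "1 / t" q]] by simp

lemma poly_deg_qfall: "poly_deg n (\<lambda>x. qfall q a x n)"
proof -
  have "poly_deg (Suc 0) (\<lambda>x. x - z)" for z
    using poly_deg_linear[of "-z" 1] by simp
  then show ?thesis
    unfolding qfall_def by (intro poly_deg_prod)
qed

lemma poly_deg_vwp_sum: "poly_deg n (\<lambda>b. vwp_sum q t b c d\<^sub>1 d\<^sub>2 a\<^sub>1 a\<^sub>2 n)"
  unfolding vwp_sum_def
proof (rule poly_deg_sum[OF finite_atMost])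
  fix j assume j: "j \<in> {..n}"
  have "poly_deg n (\<lambda>b. V * qpair q t b j (n - j))" for V
    using poly_deg_cmult[OF poly_deg_qpair[of j "n - j" q t]] j by simp
  from this[of "V * (C * D\<^sub>1 * D\<^sub>2) / R" for V C D\<^sub>1 D\<^sub>2 R]
  have "poly_deg n (\<lambda>b. V * (qpair q t b j (n - j) * C * D\<^sub>1 * D\<^sub>2) / R)" for V C D\<^sub>1 D\<^sub>2 R
    by (simp add: mult_ac)
  then show "poly_deg n (\<lambda>b. (t * q ^ j - q ^ (n - j)) / (t - 1) *
       (qpair q t b j (n - j) * qpair q t c j (n - j) * qpair q t d\<^sub>1 j (n - j) * qpair q t d\<^sub>2 j (n - j))
       / (qpair q t q j (n - j) * qpair q t (t * q) j (n - j) *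
          qpair q t (a\<^sub>1 * q) j (n - j) * qpair q t (a\<^sub>2 * q) j (n - j)))" .
qed

lemma poly_deg_dual_sum: "poly_deg n (\<lambda>b. dual_sum q t b c d\<^sub>1 d\<^sub>2 a\<^sub>1 a\<^sub>2 n)"
  unfolding dual_sum_def
proof (rule poly_deg_sum[OF finite_atMost])
  fix j assume j: "j \<in> {..n}"
  have "poly_deg n (\<lambda>b. V * (qfall q a\<^sub>1 b j * qfall q a\<^sub>2 b (n - j)))" for V
    using poly_deg_cmult[OF poly_deg_mult[OF poly_deg_qfall[of j q a\<^sub>1] poly_deg_qfall[of "n - j" q a\<^sub>2]]] j by simp
  from this[of "V * C" for V C]
  have "poly_deg n (\<lambda>b. V * (qfall q a\<^sub>1 b j * qfall q a\<^sub>2 b (n - j) * C))" for V C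
    by (simp add: mult_ac)
  then show "poly_deg n (\<lambda>b. (a\<^sub>1 * q ^ j - a\<^sub>2 * q ^ (n - j)) / (a\<^sub>1 - a\<^sub>2) *
        dual_wt q t d\<^sub>1 d\<^sub>2 a\<^sub>1 a\<^sub>2 j (n - j) *
        (qfall q a\<^sub>1 b j * qfall q a\<^sub>2 b (n - j) * (qfall q a\<^sub>1 c j * qfall q a\<^sub>2 c (n - j))))" .
qed

lemma poly_deg_euler_sum: "poly_deg n (\<lambda>b. euler_sum q t b c d\<^sub>1 d\<^sub>2 a\<^sub>1 a\<^sub>2 n)"
  unfolding euler_sum_def
proof (rule poly_deg_sum[OF finite_atMost])
  fix l assume l: "l \<in> {..n}"
  have "poly_deg (n - l) (\<lambda>b. qbin q (b * k) (n - l))" for k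
    unfolding qbin_def using poly_deg_cmult[OF poly_deg_qpoch[of "n - l" k q], of "1 / qpoch q q (n - l)"] by simp
  from poly_deg_mult[OF this[of "c * d\<^sub>1 * d\<^sub>2 / (t * a\<^sub>1 * a\<^sub>2 * q ^ 2)"] poly_deg_dual_sum[of l q t c d\<^sub>1 d\<^sub>2 a\<^sub>1 a\<^sub>2]] l
  show "poly_deg n (\<lambda>b. qbin q (b * c * d\<^sub>1 * d\<^sub>2 / (t * a\<^sub>1 * a\<^sub>2 * q ^ 2)) (n - l) * dual_sum q t b c d\<^sub>1 d\<^sub>2 a\<^sub>1 a\<^sub>2 l)"
    by (simp add: mult.assoc)
qed

section \<open>The Euler transformation\<close>

text \<open>
  At \<open>d\<^sub>1 = a\<^sub>1 q\<close>, \<open>d\<^sub>2 = a\<^sub>2 q\<close> both denominator pairs cancel on the left and only the term with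
  \<open>l = 0\<close> survives on the right, so the claim is the 6W5 sum. Since \<open>b, c, d\<^sub>1, d\<^sub>2\<close> enter
  symmetrically, \<open>contiguous_eq_0\<close> removes first the condition on \<open>d\<^sub>1\<close> and then that on \<open>d\<^sub>2\<close>.
\<close>
theorem euler_transformation:
  fixes q t b c d\<^sub>1 d\<^sub>2 a\<^sub>1 a\<^sub>2 :: complex
  assumes q: "q \<noteq> 0" "norm q < 1" and t: "t \<noteq> 0" "t \<noteq> 1" and a: "a\<^sub>1 \<noteq> 0" "a\<^sub>2 \<noteq> 0" "a\<^sub>1 \<noteq> a\<^sub>2"
    and tq: "qpoch (t * q) q n \<noteq> 0" "qpoch (q / t) q n \<noteq> 0"
    and nz1: "qpoch (a\<^sub>1 / a\<^sub>2 * q) q n \<noteq> 0" "qpoch (a\<^sub>1 * q) q n \<noteq> 0" "qpoch (a\<^sub>1 / t * q) q n \<noteq> 0"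
    and nz2: "qpoch (a\<^sub>2 / a\<^sub>1 * q) q n \<noteq> 0" "qpoch (a\<^sub>2 * q) q n \<noteq> 0" "qpoch (a\<^sub>2 / t * q) q n \<noteq> 0"
  shows "vwp_sum q t b c d\<^sub>1 d\<^sub>2 a\<^sub>1 a\<^sub>2 n = euler_sum q t b c d\<^sub>1 d\<^sub>2 a\<^sub>1 a\<^sub>2 n"
proof -
  define D where "D b c d\<^sub>1 d\<^sub>2 = vwp_sum q t b c d\<^sub>1 d\<^sub>2 a\<^sub>1 a\<^sub>2 n - euler_sum q t b c d\<^sub>1 d\<^sub>2 a\<^sub>1 a\<^sub>2 n" for b c d\<^sub>1 d\<^sub>2
  have swap: "D b c d\<^sub>1 d\<^sub>2 = D c b d\<^sub>1 d\<^sub>2" "D b c d\<^sub>1 d\<^sub>2 = D b d\<^sub>1 c d\<^sub>2" "D b c d\<^sub>1 d\<^sub>2 = D b d\<^sub>2 c d\<^sub>1" for b c d\<^sub>1 d\<^sub>2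
    by (simp_all add: D_def vwp_sum_def euler_sum_def dual_sum_def dual_wt_def mult_ac)
  have deg: "poly_deg n (\<lambda>b. D b c d\<^sub>1 d\<^sub>2)" for c d\<^sub>1 d\<^sub>2
    unfolding D_def by (intro poly_deg_diff poly_deg_vwp_sum poly_deg_euler_sum)
  have deg': "poly_deg n (\<lambda>c. D b c d\<^sub>1 d\<^sub>2)" for b d\<^sub>1 d\<^sub>2
    unfolding swap(1)[of b] by (rule deg)
  have contiguous: "c * (1 - b) * (1 - b / t) * D (b * q) c d\<^sub>1 d\<^sub>2 - b * (1 - c) * (1 - c / t) * D b (c * q) d\<^sub>1 d\<^sub>2
      = (c - b) * (1 - b * c / t * q ^ n) * D b c d\<^sub>1 d\<^sub>2" for b c d\<^sub>1 d\<^sub>2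
  proof -
    have difference: "x * (v\<^sub>1 - e\<^sub>1) - y * (v\<^sub>2 - e\<^sub>2) = z * (v\<^sub>3 - e\<^sub>3)"
      if "x * v\<^sub>1 - y * v\<^sub>2 = z * v\<^sub>3" "x * e\<^sub>1 - y * e\<^sub>2 = z * e\<^sub>3"
      for x y z v\<^sub>1 v\<^sub>2 v\<^sub>3 e\<^sub>1 e\<^sub>2 e\<^sub>3 :: complex
      using that by algebra
    show ?thesis
      unfolding D_def
      by (rule difference[OF vwp_sum_contiguous euler_sum_contiguous[OF q t(1) a nz1 nz2]])
  qed
  have reduce: "D b c d\<^sub>1 d\<^sub>2 = 0"
    if "a \<in> {a\<^sub>1, a\<^sub>2}" "\<And>b. D b (a * q) d\<^sub>1 d\<^sub>2 = 0" for a b c d\<^sub>1 d\<^sub>2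
  proof (rule contiguous_eq_0[OF q t(1), where D = "\<lambda>b c. D b c d\<^sub>1 d\<^sub>2"])
    show "qpoch (a * q) q n \<noteq> 0" "qpoch (a * q / t) q n \<noteq> 0"
      using that(1) nz1 nz2 by auto
  qed (fact deg deg' contiguous that(2))+
  have base: "D b c (a\<^sub>1 * q) (a\<^sub>2 * q) = 0" for b c
  proof -
    have nz: "qpair q t q j m \<noteq> 0" "qpair q t (t * q) j m \<noteq> 0" "qpair q t (a\<^sub>1 * q) j m \<noteq> 0" "qpair q t (a\<^sub>2 * q) j m \<noteq> 0"
      if "j + m \<le> n" for j m
      using that t tq nz1 nz2 qpoch_qq_nonzero[OF q(2)] by (simp_all add: qpair_def qpoch_nonzero_mono[of _ q n])
    have "vwp_sum q t b c (a\<^sub>1 * q) (a\<^sub>2 * q) a\<^sub>1 a\<^sub>2 n = (\<Sum>j\<le>n. (t * q ^ j - q ^ (n - j)) / (t - 1) *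
       (qpair q t b j (n - j) * qpair q t c j (n - j) / (qpair q t q j (n - j) * qpair q t (t * q) j (n - j))))"
      unfolding vwp_sum_def by (intro sum.cong refl) (simp add: nz)
    also have "\<dots> = qbin q (b * c / t) n"
      using nz by (intro terminating_6W5 q t) auto
    also have "\<dots> = euler_sum q t b c (a\<^sub>1 * q) (a\<^sub>2 * q) a\<^sub>1 a\<^sub>2 n"
    proof -
      have "qfall q a (a * q) k = (if k = 0 then 1 else 0)" for a k
        by (auto simp: qfall_def intro!: bexI[of _ 0])
      then have wt: "dual_wt q t (a\<^sub>1 * q) (a\<^sub>2 * q) a\<^sub>1 a\<^sub>2 j m = (if j = 0 \<and> m = 0 then 1 else 0)" for j m
        by (simp add: dual_wt_def)
      have dual: "dual_sum q t b c (a\<^sub>1 * q) (a\<^sub>2 * q) a\<^sub>1 a\<^sub>2 l = (if l = 0 then 1 else 0)" for l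
      proof (cases "l = 0")
        case True
        then show ?thesis
          using a by (simp add: dual_sum_def wt)
      next
        case False
        then show ?thesis
          unfolding dual_sum_def wt by (intro sum.neutral[THEN trans]) auto
      qed
      have A: "b * c * (a\<^sub>1 * q) * (a\<^sub>2 * q) / (t * a\<^sub>1 * a\<^sub>2 * q ^ 2) = b * c / t"
        using q t a by (simp add: power2_eq_square)
      have delta: "(\<Sum>l\<le>n. g l * (if l = 0 then 1 else 0)) = g 0" for g :: "nat \<Rightarrow> complex"
        by (subst sum.remove[of _ 0]) (auto intro!: sum.neutral)
      show ?thesis
        unfolding euler_sum_def dual A delta by (simp only: diff_zero)
    qed
    finally show ?thesis
      by (simp add: D_def)
  qed
  have base': "D b c d (a\<^sub>2 * q) = 0" for b c d
  proof (rule reduce[of a\<^sub>1])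
    show "D b (a\<^sub>1 * q) d (a\<^sub>2 * q) = 0" for b
      using base[of b d] swap(2)[of b "a\<^sub>1 * q" d "a\<^sub>2 * q"] by simp
  qed simp
  have "D b c d\<^sub>1 d\<^sub>2 = 0"
  proof (rule reduce[of a\<^sub>2])
    show "D b (a\<^sub>2 * q) d\<^sub>1 d\<^sub>2 = 0" for b
      using base'[of b d\<^sub>1 d\<^sub>2] swap(3)[of b d\<^sub>1 d\<^sub>2 "a\<^sub>2 * q"] by simp
  qed simp
  then show ?thesis
    unfolding D_def by simp
qed

text \<open>
  The dual sum lives on the variables \<open>a\<^sub>1\<close> and \<open>a\<^sub>2\<close>, that is, on \<open>t/e\<close> and \<open>t/f\<close> in place of \<open>t\<close> and \<open>1\<close>.
\<close>
lemma dual_sum_eq_vwp_sum: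
  fixes q t b c d h a\<^sub>1 a\<^sub>2 :: complex
  assumes nz: "b \<noteq> 0" "c \<noteq> 0" "d \<noteq> 0" "h \<noteq> 0" and a: "a\<^sub>1 \<noteq> 0" "a\<^sub>2 \<noteq> 0"
  shows "dual_sum q t b c d h a\<^sub>1 a\<^sub>2 n = (b * c * d * h / (t * a\<^sub>1 * a\<^sub>2 * q ^ 2)) ^ n *
     vwp_sum q (a\<^sub>1 / a\<^sub>2) (a\<^sub>1 * q / c) (a\<^sub>1 * q / b) (a\<^sub>1 * q / d) (a\<^sub>1 * q / h) a\<^sub>1 (a\<^sub>1 / t) n"
  unfolding dual_sum_def vwp_sum_def sum_distrib_left
proof (intro sum.cong refl)
  fix j assume "j \<in> {..n}"
  define m where "m = n - j"
  have n: "n = j + m"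
    using \<open>j \<in> {..n}\<close> by (simp add: m_def)
  have V: "(a\<^sub>1 / a\<^sub>2 * q ^ j - q ^ m) / (a\<^sub>1 / a\<^sub>2 - 1) = (a\<^sub>1 * q ^ j - a\<^sub>2 * q ^ m) / (a\<^sub>1 - a\<^sub>2)"
  proof -
    have "a\<^sub>1 / a\<^sub>2 * q ^ j - q ^ m = (a\<^sub>1 * q ^ j - a\<^sub>2 * q ^ m) / a\<^sub>2" "a\<^sub>1 / a\<^sub>2 - 1 = (a\<^sub>1 - a\<^sub>2) / a\<^sub>2"
      using a by (simp_all add: field_simps)
    then show ?thesis
      using a by simp
  qed
  have num: "qfall q a\<^sub>1 p j * qfall q a\<^sub>2 p m = p ^ n * qpair q (a\<^sub>1 / a\<^sub>2) (a\<^sub>1 * q / p) j m" if "p \<noteq> 0" for p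
    using that a by (simp add: qfall_eq_qpoch qpair_def n power_add mult_ac)
  have den: "qpair q (a\<^sub>1 / a\<^sub>2) q j m * qpair q (a\<^sub>1 / a\<^sub>2) (a\<^sub>1 / a\<^sub>2 * q) j m *
      qpair q (a\<^sub>1 / a\<^sub>2) (a\<^sub>1 * q) j m * qpair q (a\<^sub>1 / a\<^sub>2) (a\<^sub>1 / t * q) j m
    = (qpoch q q j * qpoch (a\<^sub>1 / a\<^sub>2 * q) q j * qpoch (a\<^sub>1 * q) q j * qpoch (a\<^sub>1 / t * q) q j) *
      (qpoch q q m * qpoch (a\<^sub>2 / a\<^sub>1 * q) q m * qpoch (a\<^sub>2 * q) q m * qpoch (a\<^sub>2 / t * q) q m)"
    using a by (simp add: qpair_def mult_ac)
  have "(a\<^sub>1 * q ^ j - a\<^sub>2 * q ^ m) / (a\<^sub>1 - a\<^sub>2) * dual_wt q t d h a\<^sub>1 a\<^sub>2 j m *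
       (qfall q a\<^sub>1 b j * qfall q a\<^sub>2 b m * (qfall q a\<^sub>1 c j * qfall q a\<^sub>2 c m))
    = (a\<^sub>1 * q ^ j - a\<^sub>2 * q ^ m) / (a\<^sub>1 - a\<^sub>2) * (1 / (t * a\<^sub>1 * a\<^sub>2 * q ^ 2)) ^ n *
      ((qfall q a\<^sub>1 b j * qfall q a\<^sub>2 b m) * (qfall q a\<^sub>1 c j * qfall q a\<^sub>2 c m) * (qfall q a\<^sub>1 d j * qfall q a\<^sub>2 d m) *
       (qfall q a\<^sub>1 h j * qfall q a\<^sub>2 h m))
      / ((qpoch q q j * qpoch (a\<^sub>1 / a\<^sub>2 * q) q j * qpoch (a\<^sub>1 * q) q j * qpoch (a\<^sub>1 / t * q) q j) *
      (qpoch q q m * qpoch (a\<^sub>2 / a\<^sub>1 * q) q m * qpoch (a\<^sub>2 * q) q m * qpoch (a\<^sub>2 / t * q) q m))"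
    unfolding dual_wt_def n divide_inverse inverse_mult_distrib by (simp only: mult_ac)
  also have "\<dots> = (b * c * d * h / (t * a\<^sub>1 * a\<^sub>2 * q ^ 2)) ^ n * ((a\<^sub>1 / a\<^sub>2 * q ^ j - q ^ m) / (a\<^sub>1 / a\<^sub>2 - 1) *
       (qpair q (a\<^sub>1 / a\<^sub>2) (a\<^sub>1 * q / c) j m * qpair q (a\<^sub>1 / a\<^sub>2) (a\<^sub>1 * q / b) j m * qpair q (a\<^sub>1 / a\<^sub>2) (a\<^sub>1 * q / d) j m * qpair q (a\<^sub>1 / a\<^sub>2) (a\<^sub>1 * q / h) j m)
       / (qpair q (a\<^sub>1 / a\<^sub>2) q j m * qpair q (a\<^sub>1 / a\<^sub>2) (a\<^sub>1 / a\<^sub>2 * q) j m *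
      qpair q (a\<^sub>1 / a\<^sub>2) (a\<^sub>1 * q) j m * qpair q (a\<^sub>1 / a\<^sub>2) (a\<^sub>1 / t * q) j m))"
    unfolding num[OF nz(1)] num[OF nz(2)] num[OF nz(3)] num[OF nz(4)] V den
    unfolding divide_inverse inverse_mult_distrib power_mult_distrib by (simp only: power_one mult_1_left mult_ac)
  finally show "(a\<^sub>1 * q ^ j - a\<^sub>2 * q ^ (n - j)) / (a\<^sub>1 - a\<^sub>2) * dual_wt q t d h a\<^sub>1 a\<^sub>2 j (n - j) *
       (qfall q a\<^sub>1 b j * qfall q a\<^sub>2 b (n - j) * (qfall q a\<^sub>1 c j * qfall q a\<^sub>2 c (n - j))) =
     (b * c * d * h / (t * a\<^sub>1 * a\<^sub>2 * q ^ 2)) ^ n * ((a\<^sub>1 / a\<^sub>2 * q ^ j - q ^ (n - j)) / (a\<^sub>1 / a\<^sub>2 - 1) *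
       (qpair q (a\<^sub>1 / a\<^sub>2) (a\<^sub>1 * q / c) j (n - j) * qpair q (a\<^sub>1 / a\<^sub>2) (a\<^sub>1 * q / b) j (n - j) * qpair q (a\<^sub>1 / a\<^sub>2) (a\<^sub>1 * q / d) j (n - j) * qpair q (a\<^sub>1 / a\<^sub>2) (a\<^sub>1 * q / h) j (n - j))
       / (qpair q (a\<^sub>1 / a\<^sub>2) q j (n - j) * qpair q (a\<^sub>1 / a\<^sub>2) (a\<^sub>1 / a\<^sub>2 * q) j (n - j) *
      qpair q (a\<^sub>1 / a\<^sub>2) (a\<^sub>1 * q) j (n - j) * qpair q (a\<^sub>1 / a\<^sub>2) (a\<^sub>1 / t * q) j (n - j)))"
    unfolding m_def .
qed

section \<open>The Euler transformation with one denominator pair\<close>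

text \<open>
  The case of \<open>vwp_sum\<close> in which one numerator pair cancels one denominator pair, multiplied by
  \<open>(aq/t)_N\<close>. The quotient \<open>(aq/t)_N / (aq/t)_m\<close> is written without division: for the 8W7 series of the
  theorem \<open>(aq/t)_N\<close> is proportional to \<open>(\<phi>)_N\<close>, which may vanish.
\<close>
definition one_pair_sum ::
  "complex \<Rightarrow> complex \<Rightarrow> complex \<Rightarrow> complex \<Rightarrow> complex \<Rightarrow> nat \<Rightarrow> nat \<Rightarrow> complex \<Rightarrow> complex" where
  "one_pair_sum q t b c d N n a = (\<Sum>j\<le>n. (t * q ^ j - q ^ (n - j)) / (t - 1) *
     (qpair q t b j (n - j) * qpair q t c j (n - j) * qpair q t d j (n - j)) /
     (qpair q t q j (n - j) * qpair q t (t * q) j (n - j) * qpoch (a * q) q j) *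
     qpoch (a / t * q * q ^ (n - j)) q (N - (n - j)))"

definition one_pair_term ::
  "complex \<Rightarrow> complex \<Rightarrow> complex \<Rightarrow> complex \<Rightarrow> complex \<Rightarrow> nat \<Rightarrow> complex \<Rightarrow> nat \<Rightarrow> complex" where
  "one_pair_term q t b c d N a l = (1 / (t * a * q)) ^ l *
     (qfall q a b l * qfall q a c l * qfall q a d l) / (qpoch q q l * qpoch (a * q) q l) *
     qpoch (a / t * q * q ^ l) q (N - l)"

text \<open>
  The Euler transformation at \<open>d\<^sub>2 = eq\<close>, \<open>a\<^sub>1 = e\<close>. Then only \<open>j = 0\<close> contributes to the dual sum,
  which becomes a product, and the auxiliary \<open>e\<close> disappears from both sides. Any \<open>e\<close> outside a finite set
  satisfies the nonvanishing conditions.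
\<close>
lemma one_pair_transformation_generic:
  fixes q t b c d a :: complex
  assumes q: "q \<noteq> 0" "norm q < 1" and t: "t \<noteq> 0" "t \<noteq> 1"
    and tq: "qpoch (t * q) q n \<noteq> 0" "qpoch (q / t) q n \<noteq> 0"
    and a: "a \<noteq> 0" "qpoch (a * q) q n \<noteq> 0" "qpoch (a / t * q) q N \<noteq> 0" and "n \<le> N"
  shows "one_pair_sum q t b c d N n a = (\<Sum>l\<le>n. qbin q (b * c * d / (t * a * q)) (n - l) * one_pair_term q t b c d N a l)"
proof -
  \<comment> \<open>The values of \<open>e\<close> for which a denominator of the transformation vanishes.\<close>
  define bad where "bad = {0, a} \<union> (\<lambda>i. a / q ^ Suc i) ` {..<n} \<union> (\<lambda>i. 1 / q ^ Suc i) ` {..<n}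
    \<union> (\<lambda>i. t / q ^ Suc i) ` {..<n} \<union> (\<lambda>i. a * q ^ Suc i) ` {..<n}"
  have "finite bad"
    by (simp add: bad_def)
  then obtain e where e: "e \<notin> bad"
    using ex_new_if_finite[OF infinite_UNIV_char_0] by blast
  then have e0: "e \<noteq> 0" "e \<noteq> a"
    by (auto simp: bad_def)
  have zero: "\<exists>i<n. x * q ^ Suc i = 1" if "qpoch (x * q) q n = 0" for x
    using that by (auto simp: qpoch_eq_0_iff mult_ac)
  have nz1: "qpoch (e / a * q) q n \<noteq> 0" "qpoch (e * q) q n \<noteq> 0" "qpoch (e / t * q) q n \<noteq> 0"
    and nz2: "qpoch (a / e * q) q n \<noteq> 0"
    using e q t a e0 by (force dest!: zero simp: bad_def field_simps)+
  have aN: "qpoch (a / t * q) q n \<noteq> 0"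
    using a(3) \<open>n \<le> N\<close> by (rule qpoch_nonzero_mono)
  have split: "qpoch (a / t * q) q N = qpoch (a / t * q) q m * qpoch (a / t * q * q ^ m) q (N - m)" "qpoch (a / t * q) q m \<noteq> 0"
    if "m \<le> n" for m
    using qpoch_add[of "a / t * q" q m "N - m"] qpoch_nonzero_mono[OF aN that] that \<open>n \<le> N\<close> by auto
  have "one_pair_sum q t b c d N n a = qpoch (a / t * q) q N * vwp_sum q t b c d (e * q) e a n"
    unfolding one_pair_sum_def vwp_sum_def sum_distrib_left
  proof (intro sum.cong refl)
    fix j assume j: "j \<in> {..n}"
    have "qpair q t (e * q) j (n - j) \<noteq> 0"
      using nz1 j by (simp add: qpair_def qpoch_nonzero_mono[of _ q n])
    moreover have "qpair q t (a * q) j (n - j) = qpoch (a * q) q j * qpoch (a / t * q) q (n - j)"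
      by (simp add: qpair_def)
    ultimately show "(t * q ^ j - q ^ (n - j)) / (t - 1) *
       (qpair q t b j (n - j) * qpair q t c j (n - j) * qpair q t d j (n - j)) /
       (qpair q t q j (n - j) * qpair q t (t * q) j (n - j) * qpoch (a * q) q j) *
       qpoch (a / t * q * q ^ (n - j)) q (N - (n - j))
     = qpoch (a / t * q) q N * ((t * q ^ j - q ^ (n - j)) / (t - 1) *
       (qpair q t b j (n - j) * qpair q t c j (n - j) * qpair q t d j (n - j) * qpair q t (e * q) j (n - j))
       / (qpair q t q j (n - j) * qpair q t (t * q) j (n - j) * qpair q t (e * q) j (n - j) * qpair q t (a * q) j (n - j)))"
      unfolding split(1)[of "n - j", OF diff_le_self] using split(2)[of "n - j", OF diff_le_self] by (simp add: mult_ac)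
  qed
  also have "vwp_sum q t b c d (e * q) e a n = euler_sum q t b c d (e * q) e a n"
    using e0 by (intro euler_transformation q t a(1,2) tq nz1 nz2 aN)
  also have "qpoch (a / t * q) q N * \<dots> = (\<Sum>l\<le>n. qbin q (b * c * d / (t * a * q)) (n - l) * one_pair_term q t b c d N a l)"
  proof -
    have A: "b * c * d * (e * q) / (t * e * a * q ^ 2) = b * c * d / (t * a * q)"
      using e0 q by (simp add: power2_eq_square mult_ac)
    have fall: "qfall q e (e * q) j = (if j = 0 then 1 else 0)" for j
      by (auto simp: qfall_def intro!: bexI[of _ 0])
    have "qpoch (a / t * q) q N * dual_sum q t b c d (e * q) e a l = one_pair_term q t b c d N a l" if l: "l \<le> n" for l
    proof -
      have "dual_sum q t b c d (e * q) e a l = (e - a * q ^ l) / (e - a) * dual_wt q t d (e * q) e a 0 l * (qfall q a b l * qfall q a c l)"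
        unfolding dual_sum_def by (subst sum.remove[of _ 0]) (auto intro!: sum.neutral simp: dual_wt_def fall)
      also have "\<dots> = (1 / (t * a * q)) ^ l *
        (qfall q a b l * qfall q a c l * qfall q a d l) / (qpoch q q l * qpoch (a * q) q l * qpoch (a / t * q) q l)"
      proof -
        have qe: "qfall q a (e * q) l = (e * q) ^ l * qpoch (a / e) q l"
        proof -
          have "qfall q a (e * q) l = (\<Prod>i<l. e * q * (1 - a / e * q ^ i))"
            unfolding qfall_def using e0 by (intro prod.cong refl) (simp add: field_simps)
          then show ?thesis
            unfolding prod.distrib qpoch_def by (simp add: power_mult_distrib)
        qed
        have "(1 - a / e) * qpoch (a / e * q) q l = qpoch (a / e) q l * (1 - a / e * q ^ l)"
          by (rule qpoch_shift)
        then have "(e - a * q ^ l) / (e - a) * (qpoch (a / e) q l / qpoch (a / e * q) q l) = 1"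
          using e0 qpoch_nonzero_mono[OF nz2 l] by (simp add: field_simps)
        moreover have "(1 / (t * e * a * q ^ 2)) ^ l * (e * q) ^ l = (1 / (t * a * q)) ^ l"
          unfolding power_mult_distrib[symmetric] using e0 q by (simp add: power2_eq_square mult_ac)
        moreover have "(e - a * q ^ l) / (e - a) * dual_wt q t d (e * q) e a 0 l * (qfall q a b l * qfall q a c l)
          = ((1 / (t * e * a * q ^ 2)) ^ l * (e * q) ^ l) * ((e - a * q ^ l) / (e - a) * (qpoch (a / e) q l / qpoch (a / e * q) q l)) *
            (qfall q a b l * qfall q a c l * qfall q a d l) / (qpoch q q l * qpoch (a * q) q l * qpoch (a / t * q) q l)"
          unfolding dual_wt_def qe by (simp add: mult_ac)
        ultimately show ?thesis
          by simp
      qed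
      finally show ?thesis
        unfolding one_pair_term_def split(1)[OF l] using split(2)[OF l] by simp
    qed
    then show ?thesis
      unfolding euler_sum_def A sum_distrib_left by (intro sum.cong refl) (simp add: mult_ac)
  qed
  finally show ?thesis .
qed

lemma isCont_qpoch [continuous_intros]:
  fixes f :: "complex \<Rightarrow> complex"
  assumes "isCont f x"
  shows "isCont (\<lambda>x. qpoch (f x) q n) x"
  unfolding qpoch_def using assms by (intro continuous_intros)

text \<open>
  The zeros of \<open>(aq/t)_N\<close> as a function of \<open>a\<close> are isolated and both sides are continuous in \<open>a\<close>. This
  is Watson's transformation of a terminating 8W7 series.
\<close>
lemma one_pair_transformation:
  fixes q t b c d a :: complex
  assumes q: "q \<noteq> 0" "norm q < 1" and t: "t \<noteq> 0" "t \<noteq> 1"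
    and tq: "qpoch (t * q) q n \<noteq> 0" "qpoch (q / t) q n \<noteq> 0"
    and a: "a \<noteq> 0" "qpoch (a * q) q n \<noteq> 0" and "n \<le> N"
  shows "one_pair_sum q t b c d N n a = (\<Sum>l\<le>n. qbin q (b * c * d / (t * a * q)) (n - l) * one_pair_term q t b c d N a l)"
    (is "?L a = ?R a")
proof -
  have nz: "qpoch (a * q) q j \<noteq> 0" if "j \<le> n" for j
    using a(2) that by (rule qpoch_nonzero_mono)
  have qpair: "qpair q t q j m \<noteq> 0" "qpair q t (t * q) j m \<noteq> 0" if "j + m \<le> n" for j m
    using that t tq qpoch_qq_nonzero[OF q(2)] by (simp_all add: qpair_def qpoch_nonzero_mono[of _ q n])
  have "isCont ?L a"
    unfolding one_pair_sum_def using q t nz qpair by (intro continuous_intros) auto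
  moreover have "isCont ?R a"
    unfolding one_pair_term_def qbin_def qfall_def using q t a nz qpoch_qq_nonzero[OF q(2)] by (intro continuous_intros) auto
  moreover have "eventually (\<lambda>x. ?L x = ?R x) (at a)"
  proof -
    define bad where "bad = {0} \<union> (\<lambda>i. 1 / q ^ Suc i) ` {..<n} \<union> (\<lambda>i. t / q ^ Suc i) ` {..<N}"
    have "open (- (bad - {a}))"
      by (intro open_Compl finite_imp_closed) (simp add: bad_def)
    moreover have "a \<in> - (bad - {a})"
      by simp
    ultimately have "eventually (\<lambda>x. x \<notin> bad) (at a)"
      unfolding eventually_at_topological by blast
    then show ?thesis
    proof (rule eventually_mono)
      fix x assume x: "x \<notin> bad"
      have zero: "\<exists>i<k. y * q ^ Suc i = 1" if "qpoch (y * q) q k = 0" for y k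
        using that by (auto simp: qpoch_eq_0_iff mult_ac)
      have "x \<noteq> 0" "qpoch (x * q) q n \<noteq> 0" "qpoch (x / t * q) q N \<noteq> 0"
        using x q t by (force dest!: zero simp: bad_def field_simps)+
      then show "?L x = ?R x"
        using assms by (intro one_pair_transformation_generic)
    qed
  qed
  ultimately have "(?R \<longlongrightarrow> ?L a) (at a)" "(?R \<longlongrightarrow> ?R a) (at a)"
    by (auto simp: isCont_def elim: tendsto_cong[THEN iffD1, rotated])
  then show ?thesis
    by (rule tendsto_unique[rotated 1]) simp
qed

section \<open>The series as very well-poised sums\<close>

text \<open>
  The shape of a 10W9 term after all factorials of length \<open>K\<close> have been reversed (subscript \<open>j\<close> for the
  reversed part, \<open>m\<close> for the rest): the reversed parts and the signs \<open>\<rho>\<close> cancel, and the powers in \<open>xb, \<dots>\<close>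
  and \<open>yq, \<dots>\<close> are absorbed by the argument \<open>u\<close> of the series.
\<close>
lemma vwp_term_cancel:
  fixes \<rho> :: complex
  assumes "\<rho> \<noteq> 0" "Bj \<noteq> 0" "Cj \<noteq> 0" "Dj \<noteq> 0" "Hj \<noteq> 0" "Qj \<noteq> 0" "Ej \<noteq> 0" "Fj \<noteq> 0" "Tj \<noteq> 0"
    and "y \<noteq> 0" and xu: "xb * xc * xd * xh * u = y" and y: "yq * yt * ye * yf = y"
  shows "(Bm * Bj * (xb * \<rho>)) * ((Cm * Cj * (xc * \<rho>)) * ((Dm * Dj * (xd * \<rho>)) * (Hm * Hj * (xh * \<rho>))))
     / ((Qm * Qj * (yq * \<rho>)) * ((Tm * Tj * (yt * \<rho>)) * ((Em * Ej * (ye * \<rho>)) * (Fm * Fj * (yf * \<rho>)))))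
     * (v / v0 * (aj * (b * (c * (d * (h * (Ej * (Fj * Qj)))))) / (k * (Bj * (Cj * (Dj * (Hj * (e * (f * g))))))) ) * u)
   = v * aj / (v0 * (Tm * Tj)) * (b * Bm * (c * Cm) * (d * Dm) * (h * Hm)) / (k * (g * Qm) * (e * Em) * (f * Fm))"
  (is "?lhs = ?rhs")
proof -
  have "yq \<noteq> 0" "yt \<noteq> 0" "ye \<noteq> 0" "yf \<noteq> 0"
    using y \<open>y \<noteq> 0\<close> by auto
  have "?lhs = xb * xc * xd * xh * u / (yq * yt * ye * yf) * ?rhs"
    using assms(1-9) by (simp add: mult_ac)
  then show ?thesis
    unfolding xu y using \<open>y \<noteq> 0\<close> by simp
qed

text \<open>
  All parameters that carry \<open>q^(-K)\<close>, and all denominators \<open>t q^(1-K) / p\<close>, combine with the prefactor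
  by reversal.
\<close>
lemma vwp_sum_eq_W:
  fixes q t b c d h e f :: complex
  assumes q: "q \<noteq> 0" and t: "t \<noteq> 0" "t \<noteq> 1"
    and nz: "b \<noteq> 0" "c \<noteq> 0" "d \<noteq> 0" "h \<noteq> 0" "e \<noteq> 0" "f \<noteq> 0"
    and pre: "qpochs [q, 1 / t, q / e, q / f] q K \<noteq> 0"
    and gen: "W_generic (t * q powi (- int K))
        [b, c, d, h, e * q powi (- int K), f * q powi (- int K), q powi (- int K)] q K"
  shows "qpochs [b / t, c / t, d / t, h / t] q K / qpochs [q, 1 / t, q / e, q / f] q K *
      W (t * q powi (- int K)) [b, c, d, h, e * q powi (- int K), f * q powi (- int K), q powi (- int K)]
        q (t ^ 3 * q ^ 3 / (b * c * d * h * e * f))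
    = vwp_sum q t b c d h (t / e) (t / f) K"
proof -
  define a0 where "a0 = t / q ^ K"
  define u where "u = t ^ 3 * q ^ 3 / (b * c * d * h * e * f)"
  have powi: "q powi (- int K) = 1 / q ^ K" "t * (1 / q ^ K) = a0" "e * (1 / q ^ K) = e / q ^ K" "f * (1 / q ^ K) = f / q ^ K"
    by (simp_all add: power_int_minus inverse_eq_divide a0_def)
  have params: "a0 * q / (e / q ^ K) = t * q / e" "a0 * q / (f / q ^ K) = t * q / f" "a0 * q / (1 / q ^ K) = t * q"
    using q by (simp_all add: a0_def)
  have dens: "1 - a0 \<noteq> 0" "qpoch (a0 * q / b) q j \<noteq> 0" "qpoch (a0 * q / c) q j \<noteq> 0"
      "qpoch (a0 * q / d) q j \<noteq> 0" "qpoch (a0 * q / h) q j \<noteq> 0" if "j \<le> K" for j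
    using gen that unfolding W_generic_def powi by (simp_all add: qpochs_def)
  have "W_term a0 [b, c, d, h, e / q ^ K, f / q ^ K, 1 / q ^ K] q u j *
        (qpochs [b / t, c / t, d / t, h / t] q K / qpochs [q, 1 / t, q / e, q / f] q K)
      = (t * q ^ j - q ^ (K - j)) / (t - 1) *
       (qpair q t b j (K - j) * qpair q t c j (K - j) * qpair q t d j (K - j) * qpair q t h j (K - j))
       / (qpair q t q j (K - j) * qpair q t (t * q) j (K - j) *
          qpair q t (t / e * q) j (K - j) * qpair q t (t / f * q) j (K - j))" if "j \<le> K" for j
  proof -
    define m where "m = K - j"
    have K: "K = m + j"
      using that by (simp add: m_def)
    have rev: "qpoch r q K = qpoch r q m * qpoch (q / (r * q ^ K)) q j * ((r * q ^ m) ^ j * qsgn q j)"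
      if "r \<noteq> 0" for r
      unfolding K by (rule qpoch_reverse[OF q that])
    have args: "q / (p / t * q ^ K) = a0 * q / p" "q / (1 / t * q ^ K) = a0 * q" "q / (q / p * q ^ K) = p / q ^ K" "q / (q * q ^ K) = 1 / q ^ K" for p
      using q t by (simp_all add: a0_def mult_ac)
    have num: "qpoch (p / t) q K = qpoch (p / t) q m * qpoch (a0 * q / p) q j * ((p / t * q ^ m) ^ j * qsgn q j)"
      if "p \<noteq> 0" for p
      using rev[of "p / t"] that t unfolding args(1) by simp
    have den: "qpoch (q / p) q K = qpoch (q / p) q m * qpoch (p / q ^ K) q j * ((q / p * q ^ m) ^ j * qsgn q j)"
      if "p \<noteq> 0" for p
      using rev[of "q / p"] that q unfolding args(3) by simp
    have "qpoch q q K = qpoch q q m * qpoch (1 / q ^ K) q j * ((q * q ^ m) ^ j * qsgn q j)"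
      "qpoch (1 / t) q K = qpoch (1 / t) q m * qpoch (a0 * q) q j * ((1 / t * q ^ m) ^ j * qsgn q j)"
      using rev[of q] rev[of "1 / t"] q t unfolding args(2,4) by simp_all
    note revs = num[OF nz(1)] num[OF nz(2)] num[OF nz(3)] num[OF nz(4)] this den[OF nz(5)] den[OF nz(6)]
    have pre': "qpoch (1 / q ^ K) q j \<noteq> 0" "qpoch (a0 * q) q j \<noteq> 0" "qpoch (e / q ^ K) q j \<noteq> 0" "qpoch (f / q ^ K) q j \<noteq> 0"
      "qpoch (1 / t) q m \<noteq> 0"
      using pre unfolding qpochs_def list.map prod_list.Cons revs by auto
    have cancel: "(b / t * q ^ m) ^ j * (c / t * q ^ m) ^ j * (d / t * q ^ m) ^ j * (h / t * q ^ m) ^ j * u ^ j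
        = (q / t * (q / e) * (q / f) * (q ^ m) ^ 4) ^ j"
      unfolding power_mult_distrib[symmetric] using q t nz
      by (intro arg_cong[of _ _ "\<lambda>x. x ^ j"]) (simp add: u_def field_simps power2_eq_square power3_eq_cube power4_eq_xxxx)
    have cancel': "(q * q ^ m) ^ j * (1 / t * q ^ m) ^ j * (q / e * q ^ m) ^ j * (q / f * q ^ m) ^ j
        = (q / t * (q / e) * (q / f) * (q ^ m) ^ 4) ^ j"
      unfolding power_mult_distrib[symmetric]
      by (intro arg_cong[of _ _ "\<lambda>x. x ^ j"]) (simp add: power4_eq_xxxx)
    \<comment> \<open>The very well-poised factor turns into the Vandermonde quotient.\<close>
    have V: "(1 - a0 * q ^ (2 * j)) * qpoch a0 q j / ((1 - a0) * (qpoch (1 / t) q m * qpoch (a0 * q) q j))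
        = (t * q ^ j - q ^ m) / (t - 1) / qpoch (q / t) q m"
    proof -
      have a0j: "a0 * q ^ j = t / q ^ m" "a0 * q ^ (2 * j) = t * q ^ j / q ^ m"
        using q by (simp_all add: a0_def K power_add mult_2)
      have 1: "(1 - a0) * qpoch (a0 * q) q j = qpoch a0 q j * (1 - t / q ^ m)"
        unfolding qpoch_shift a0j ..
      have 2: "(1 - 1 / t) * qpoch (q / t) q m = qpoch (1 / t) q m * (1 - 1 / t * q ^ m)"
        using qpoch_shift[of "1 / t" q m] by simp
      have 3: "(1 - t / q ^ m) * qpoch (1 / t) q m = (1 - t) / q ^ m * qpoch (q / t) q m"
      proof -
        have "(1 - t / q ^ m) * qpoch (1 / t) q m = - (t / q ^ m) * (qpoch (1 / t) q m * (1 - 1 / t * q ^ m))"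
          using q t by (simp add: field_simps)
        also have "\<dots> = (1 - t) / q ^ m * qpoch (q / t) q m"
          unfolding 2[symmetric] using q t by (simp add: field_simps)
        finally show ?thesis .
      qed
      have "qpoch a0 q j * (1 - t / q ^ m) \<noteq> 0"
        using dens(1)[OF that] pre'(2) unfolding 1[symmetric] by simp
      then have nz: "qpoch a0 q j \<noteq> 0" "1 - t / q ^ m \<noteq> 0"
        by simp_all
      have "(1 - a0 * q ^ (2 * j)) * qpoch a0 q j / ((1 - a0) * (qpoch (1 / t) q m * qpoch (a0 * q) q j))
        = (1 - a0 * q ^ (2 * j)) * qpoch a0 q j / (qpoch (1 / t) q m * ((1 - a0) * qpoch (a0 * q) q j))"
        by (simp only: mult_ac)
      also have "\<dots> = (1 - t * q ^ j / q ^ m) / ((1 - t / q ^ m) * qpoch (1 / t) q m)"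
        unfolding 1 a0j using nz by (simp add: mult_ac)
      also have "\<dots> = (t * q ^ j - q ^ m) / (t - 1) / qpoch (q / t) q m"
      proof -
        have "(1 - t * q ^ j / q ^ m) / ((1 - t) / q ^ m * Z) = (t * q ^ j - q ^ m) / (t - 1) / Z" for Z
        proof -
          have eqs: "1 - t * q ^ j / q ^ m = - ((t * q ^ j - q ^ m) / q ^ m)" "(1 - t) / q ^ m * Z = - ((t - 1) * Z / q ^ m)"
            using q by (simp_all add: field_simps)
          show ?thesis
            unfolding eqs minus_divide_divide using q by simp
        qed
        then show ?thesis
          unfolding 3 .
      qed
      finally show ?thesis .
    qed
    have "qpochs [b / t, c / t, d / t, h / t] q K / qpochs [q, 1 / t, q / e, q / f] q K *
         W_term a0 [b, c, d, h, e / q ^ K, f / q ^ K, 1 / q ^ K] q u j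
      = (1 - a0 * q ^ (2 * j)) * qpoch a0 q j / ((1 - a0) * (qpoch (1 / t) q m * qpoch (a0 * q) q j)) *
        (qpoch b q j * qpoch (b / t) q m * (qpoch c q j * qpoch (c / t) q m) * (qpoch d q j * qpoch (d / t) q m) * (qpoch h q j * qpoch (h / t) q m)) /
        (qpoch q q j * (qpoch (t * q) q j * qpoch q q m) * (qpoch (t * q / e) q j * qpoch (q / e) q m) * (qpoch (t * q / f) q j * qpoch (q / f) q m))"
      unfolding W_term_def qpochs_def list.map prod_list.Cons prod_list.Nil mult_1_right params revs
      by (rule vwp_term_cancel[OF _ dens(2-5)[OF that] pre'(1,3,4,2) _ cancel cancel']) (use q t nz in \<open>simp_all add: qsgn_nonzero\<close>)
    then show ?thesis
      unfolding V qpair_def m_def[symmetric] using t by (simp add: mult_ac)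
  qed
  then have "(\<Sum>j\<le>K. W_term a0 [b, c, d, h, e / q ^ K, f / q ^ K, 1 / q ^ K] q u j *
        (qpochs [b / t, c / t, d / t, h / t] q K / qpochs [q, 1 / t, q / e, q / f] q K))
      = vwp_sum q t b c d h (t / e) (t / f) K"
    unfolding vwp_sum_def by (intro sum.cong refl) simp
  moreover have "W a0 [b, c, d, h, e / q ^ K, f / q ^ K, 1 / q ^ K] q u
      = (\<Sum>j\<le>K. W_term a0 [b, c, d, h, e / q ^ K, f / q ^ K, 1 / q ^ K] q u j)"
    by (rule W_terminating) (use q powi(1) in auto)
  ultimately show ?thesis
    unfolding powi u_def[symmetric] by (simp only: sum_distrib_right[symmetric] mult_ac)
qed

text \<open>
  The powers of \<open>q\<close>, \<open>\<sigma>\<close>, \<open>\<beta>\<close>, \<open>\<delta>\<^sub>1\<close>, \<open>\<delta>\<^sub>2\<close> and \<open>\<phi>\<close> left over by the reversals in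
  \<open>terminating_8W7\<close> combine to a quantity that depends on \<open>K\<close> and \<open>N = K + j + m\<close> alone.
\<close>
lemma terminating_8W7_powers:
  fixes q \<sigma> \<beta> \<delta>\<^sub>1 \<delta>\<^sub>2 \<phi> A :: complex
  assumes q: "q \<noteq> 0" and nz: "\<sigma> \<noteq> 0" "\<beta> \<noteq> 0" "\<delta>\<^sub>1 \<noteq> 0" "\<delta>\<^sub>2 \<noteq> 0" "\<phi> \<noteq> 0"
    and A: "A = \<beta> * \<delta>\<^sub>1 * \<delta>\<^sub>2 * \<phi> / (\<sigma> ^ 2 * q ^ (K + j + m + 1))"
  defines "y \<equiv> \<lambda>p. (\<sigma> * q ^ (K + j) * q / p) ^ m * qsgn q m"
  shows "q ^ K * (\<phi> ^ (K + j) * qsgn q (K + j)) * (y \<beta> * y \<delta>\<^sub>1 * y \<delta>\<^sub>2) * (q / A) ^ j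
     / ((q * q ^ m) ^ (K + j) * qsgn q (K + j) * ((\<sigma> * q ^ (K + j)) ^ m * qsgn q m) * q ^ m)
    = \<phi> ^ (K + j + m) * A ^ K / A ^ (K + j + m)"
proof -
  define s where "s = K + j"
  have A0: "A \<noteq> 0"
    using q nz by (simp add: A)
  define r where "r = \<sigma> * q ^ s * q / \<beta> * (\<sigma> * q ^ s * q / \<delta>\<^sub>1) * (\<sigma> * q ^ s * q / \<delta>\<^sub>2)"
  have r: "r * A * q ^ m = \<sigma> * \<phi> * q ^ s * q ^ s * q * q"
    using q nz by (simp add: r_def A s_def field_simps power_add power2_eq_square)
  have y: "y \<beta> * y \<delta>\<^sub>1 * y \<delta>\<^sub>2 = r ^ m * qsgn q m * qsgn q m * qsgn q m"
    unfolding y_def r_def s_def power_mult_distrib by (simp only: mult_ac)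
  have "(r * A) ^ m * (qsgn q m * qsgn q m) * q ^ m = (r * A * q ^ m) ^ m"
    unfolding mult.assoc[of _ "qsgn q m * qsgn q m"] qsgn_square by (simp add: power_mult_distrib power_mult)
  also have "\<dots> = (\<phi> ^ m * (q ^ m) ^ s * (\<sigma> * q ^ s) ^ m * q ^ m) * q ^ m"
    unfolding r by (simp add: power_mult_distrib mult.commute[of m s] flip: power_mult)
  finally have key: "(r * A) ^ m * (qsgn q m * qsgn q m) = \<phi> ^ m * (q ^ m) ^ s * (\<sigma> * q ^ s) ^ m * q ^ m"
    using q by simp
  have "q ^ K * (\<phi> ^ s * qsgn q s) * (r ^ m * qsgn q m * qsgn q m * qsgn q m) * (q / A) ^ j * A ^ (K + j + m)
      = \<phi> ^ s * qsgn q s * qsgn q m * q ^ s * A ^ K * ((r * A) ^ m * (qsgn q m * qsgn q m))"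
    using A0 by (simp add: s_def power_add power_divide power_mult_distrib mult_ac)
  also have "\<dots> = \<phi> ^ (K + j + m) * A ^ K * ((q * q ^ m) ^ s * qsgn q s * ((\<sigma> * q ^ s) ^ m * qsgn q m) * q ^ m)"
    unfolding key by (simp add: s_def[symmetric] power_add power_mult_distrib mult_ac)
  finally have eq: "q ^ K * (\<phi> ^ s * qsgn q s) * (r ^ m * qsgn q m * qsgn q m * qsgn q m) * (q / A) ^ j * A ^ (s + m)
      = \<phi> ^ (s + m) * A ^ K * ((q * q ^ m) ^ s * qsgn q s * ((\<sigma> * q ^ s) ^ m * qsgn q m) * q ^ m)"
    unfolding s_def .
  have "(q * q ^ m) ^ s * qsgn q s * ((\<sigma> * q ^ s) ^ m * qsgn q m) * q ^ m \<noteq> 0" "A ^ (s + m) \<noteq> 0"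
    using A0 q nz by (simp_all add: qsgn_nonzero)
  from frac_eq_eq[OF this] show ?thesis
    unfolding y s_def[symmetric] using eq by blast
qed

lemma terminating_8W7_term_cancel:
  assumes "v0 \<noteq> 0" "t \<noteq> 1" "qm \<noteq> (0::complex)"
    and "sK * sj / v0 = SN / ((1 - t) * QT * x3)" "fK * fj = F * x1" "ZK * Zj = QN / (Qm * x2)"
    and "1 / (Bk * Bj) = Bm * y1 / BN" "1 / (Ck * Cj) = Cm * y2 / CN" "1 / (Dk * Dj) = Dm * y3 / DN"
    and "v = - (w / qm)"
    and num: "qK * x1 * (y1 * y2 * y3) * u / (x2 * x3 * qm) = z"
  shows "qK * (sK * (fK * ZK) / (Bk * (Ck * Dk))) *
      (v / v0 * (sj * (b * (c * (d * (fj * Zj)))) / (k * (Bj * (Cj * (Dj * (e * g)))))) * u)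
    = SN * QN / (BN * CN * DN) * z * (w / (t - 1) * (b * Bm * (c * Cm) * (d * Dm)) / (k * QT * (g * Qm) * e) * F)"
proof -
  have "qK * (sK * (fK * ZK) / (Bk * (Ck * Dk))) *
      (v / v0 * (sj * (b * (c * (d * (fj * Zj)))) / (k * (Bj * (Cj * (Dj * (e * g)))))) * u)
    = (sK * sj / v0) * (fK * fj) * (ZK * Zj) * (1 / (Bk * Bj)) * (1 / (Ck * Cj)) * (1 / (Dk * Dj)) * v * qK * u * (b * c * d / (k * e * g))"
    by (simp only: divide_inverse inverse_mult_distrib mult_ac mult_1_left)
  also have "\<dots> = SN / ((1 - t) * QT * x3) * (F * x1) * (QN / (Qm * x2)) * (Bm * y1 / BN) * (Cm * y2 / CN) * (Dm * y3 / DN) * (- (w / qm)) * qK * u * (b * c * d / (k * e * g))"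
    unfolding assms(4-10) ..
  also have "\<dots> = SN * QN / (BN * CN * DN) * (qK * x1 * (y1 * y2 * y3) * u / (x2 * x3 * qm)) * (- w / (1 - t) * (b * Bm * (c * Cm) * (d * Dm)) / (k * QT * (g * Qm) * e) * F)"
    by (simp add: divide_inverse inverse_mult_distrib mult_ac)
  also have "- w / (1 - t) = w / (t - 1)"
    by (metis minus_diff_eq minus_divide_divide minus_minus)
  finally show ?thesis
    unfolding num .
qed

text \<open>
  With its prefactor, the 8W7 series at \<open>K\<close> is the sum of order \<open>N - K\<close> in the variables \<open>\<sigma> q^N\<close> and \<open>1\<close>,
  neither of which depends on \<open>K\<close>: factors of index \<open>K\<close> and \<open>j\<close> combine to factors of index \<open>K + j = N - m\<close>,
  which reversal turns into index \<open>m\<close>.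
\<close>
lemma terminating_8W7:
  fixes q \<sigma> \<beta> \<delta>\<^sub>1 \<delta>\<^sub>2 \<phi> A :: complex
  assumes q: "q \<noteq> 0" and nz: "\<sigma> \<noteq> 0" "\<beta> \<noteq> 0" "\<delta>\<^sub>1 \<noteq> 0" "\<delta>\<^sub>2 \<noteq> 0" "\<phi> \<noteq> 0"
    and \<sigma>: "\<And>k. k \<le> N \<Longrightarrow> \<sigma> * q ^ k \<noteq> 1" and "K \<le> N"
    and nzp: "qpoch (\<sigma> * q / \<beta>) q N \<noteq> 0" "qpoch (\<sigma> * q / \<delta>\<^sub>1) q N \<noteq> 0" "qpoch (\<sigma> * q / \<delta>\<^sub>2) q N \<noteq> 0"
    and q1: "norm q < 1"
    and A: "A = \<beta> * \<delta>\<^sub>1 * \<delta>\<^sub>2 * \<phi> / (\<sigma> ^ 2 * q ^ (N + 1))"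
  shows "q ^ K * (qpochs [\<sigma> * q, \<phi>, q powi (- int N)] q K / qpochs [\<sigma> * q / \<beta>, \<sigma> * q / \<delta>\<^sub>1, \<sigma> * q / \<delta>\<^sub>2] q K) *
      W (\<sigma> * q ^ K) [\<beta>, \<delta>\<^sub>1, \<delta>\<^sub>2, \<phi> * q ^ K, q powi (int K - int N)] q (\<sigma> ^ 2 * q ^ (N + 2) / (\<beta> * \<delta>\<^sub>1 * \<delta>\<^sub>2 * \<phi>))
    = qpoch (\<sigma> * q) q N * qpoch q q N / (qpoch (\<sigma> * q / \<beta>) q N * qpoch (\<sigma> * q / \<delta>\<^sub>1) q N * qpoch (\<sigma> * q / \<delta>\<^sub>2) q N) *
      (\<phi> ^ N * A ^ K / A ^ N) * one_pair_sum q (\<sigma> * q ^ N) \<beta> \<delta>\<^sub>1 \<delta>\<^sub>2 N (N - K) (\<sigma> / \<phi>)"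
proof -
  define t where "t = \<sigma> * q ^ N"
  define n where "n = N - K"
  have t: "t \<noteq> 0" "t \<noteq> 1"
    using q nz \<sigma>[of N] by (auto simp: t_def)
  have u: "\<sigma> ^ 2 * q ^ (N + 2) / (\<beta> * \<delta>\<^sub>1 * \<delta>\<^sub>2 * \<phi>) = q / A"
    using q nz by (simp add: A field_simps)
  have powi: "q powi (- int k) = 1 / q ^ k" for k
    by (simp add: power_int_minus inverse_eq_divide)
  have KN: "int K - int N = - int n"
    using \<open>K \<le> N\<close> by (simp add: n_def of_nat_diff)
  have N: "N = K + n"
    using \<open>K \<le> N\<close> by (simp add: n_def)
  have params: "\<sigma> * q ^ K * q / (\<phi> * q ^ K) = \<sigma> / \<phi> * q" "\<sigma> * q ^ K * q / (1 / q ^ n) = t * q"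
    using q nz by (simp_all add: t_def N power_add)
  have termwise: "q ^ K * (qpochs [\<sigma> * q, \<phi>, 1 / q ^ N] q K / qpochs [\<sigma> * q / \<beta>, \<sigma> * q / \<delta>\<^sub>1, \<sigma> * q / \<delta>\<^sub>2] q K) *
      W_term (\<sigma> * q ^ K) [\<beta>, \<delta>\<^sub>1, \<delta>\<^sub>2, \<phi> * q ^ K, 1 / q ^ n] q (q / A) j
    = qpoch (\<sigma> * q) q N * qpoch q q N / (qpoch (\<sigma> * q / \<beta>) q N * qpoch (\<sigma> * q / \<delta>\<^sub>1) q N * qpoch (\<sigma> * q / \<delta>\<^sub>2) q N) *
      (\<phi> ^ N * A ^ K / A ^ N) * ((t * q ^ j - q ^ (n - j)) / (t - 1) *
     (qpair q t \<beta> j (n - j) * qpair q t \<delta>\<^sub>1 j (n - j) * qpair q t \<delta>\<^sub>2 j (n - j)) /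
     (qpair q t q j (n - j) * qpair q t (t * q) j (n - j) * qpoch (\<sigma> / \<phi> * q) q j) *
     qpoch (\<sigma> / \<phi> / t * q * q ^ (n - j)) q (N - (n - j)))" if "j \<le> n" for j
  proof -
    define m where "m = n - j"
    define s where "s = K + j"
    have Ns: "N = s + m" "N - m = s" "N = m + s" "n = j + m"
      using that by (auto simp: s_def m_def N)
    have \<sigma>s: "1 - \<sigma> * q ^ s \<noteq> 0" "1 - \<sigma> * q ^ K \<noteq> 0"
      using \<sigma>[of s] \<sigma>[of K] Ns \<open>K \<le> N\<close> by auto
    have x3: "qpoch (\<sigma> * q) q K * qpoch (\<sigma> * q ^ K) q j / (1 - \<sigma> * q ^ K)
        = qpoch (\<sigma> * q) q N / ((1 - t) * qpoch (q / t) q m * ((\<sigma> * q ^ s) ^ m * qsgn q m))"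
    proof -
      have 1: "qpoch (\<sigma> * q) q K * qpoch (\<sigma> * q ^ K) q j * (1 - \<sigma> * q ^ s) = (1 - \<sigma> * q ^ K) * qpoch (\<sigma> * q) q s"
      proof -
        have "(1 - \<sigma> * q ^ K) * qpoch (\<sigma> * q ^ K * q) q j = qpoch (\<sigma> * q ^ K) q j * (1 - \<sigma> * q ^ K * q ^ j)"
          by (rule qpoch_shift)
        moreover have "qpoch (\<sigma> * q) q s = qpoch (\<sigma> * q) q K * qpoch (\<sigma> * q ^ K * q) q j"
          unfolding s_def qpoch_add by (simp only: mult_ac)
        ultimately show ?thesis
          by (simp add: s_def power_add mult_ac)
      qed
      have 2: "qpoch (\<sigma> * q) q N * (1 - \<sigma> * q ^ s) = qpoch (\<sigma> * q) q s * ((1 - t) * qpoch (q / t) q m * ((\<sigma> * q ^ s) ^ m * qsgn q m))"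
      proof -
        have "(1 - \<sigma> * q ^ s) * qpoch (\<sigma> * q ^ s * q) q m = qpoch (\<sigma> * q ^ s) q m * (1 - t)"
          using qpoch_shift[of "\<sigma> * q ^ s" q m] by (simp add: t_def Ns(1) power_add mult_ac)
        moreover have "qpoch (\<sigma> * q ^ s) q m = qpoch (q / t) q m * ((\<sigma> * q ^ s) ^ m * qsgn q m)"
          using qpoch_reverse[of q "\<sigma> * q ^ s" 0 m] q nz by (simp add: t_def Ns(1) power_add mult_ac)
        moreover have "qpoch (\<sigma> * q) q N = qpoch (\<sigma> * q) q s * qpoch (\<sigma> * q ^ s * q) q m"
          unfolding Ns(1) qpoch_add by (simp only: mult_ac)
        ultimately show ?thesis
          by (simp add: mult_ac)
      qed
      have "qpoch (q / t) q m \<noteq> 0"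
      proof
        assume "qpoch (q / t) q m = 0"
        then obtain i where "i < m" "q * q ^ i = t"
          using t by (auto simp: qpoch_eq_0_iff field_simps)
        moreover from \<open>i < m\<close> obtain k where "m = Suc (i + k)"
          using less_imp_Suc_add by auto
        then have "q ^ N = q * q ^ i * q ^ (N - Suc i)"
          unfolding Ns(1) by (simp add: power_add mult_ac)
        ultimately have "\<sigma> * q ^ (N - Suc i) = 1"
          using q by (simp add: t_def)
        then show False
          using \<sigma>[of "N - Suc i"] by simp
      qed
      then have D: "(1 - t) * qpoch (q / t) q m * ((\<sigma> * q ^ s) ^ m * qsgn q m) \<noteq> 0"
        using t q nz by (simp add: qsgn_nonzero)
      have "qpoch (\<sigma> * q) q K * qpoch (\<sigma> * q ^ K) q j / (1 - \<sigma> * q ^ K) = qpoch (\<sigma> * q) q s / (1 - \<sigma> * q ^ s)"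
        using 1 \<sigma>s by (simp add: frac_eq_eq mult_ac)
      also have "\<dots> = qpoch (\<sigma> * q) q N / ((1 - t) * qpoch (q / t) q m * ((\<sigma> * q ^ s) ^ m * qsgn q m))"
        unfolding frac_eq_eq[OF \<sigma>s(1) D] using 2 by simp
      finally show ?thesis .
    qed
    have x1: "qpoch \<phi> q K * qpoch (\<phi> * q ^ K) q j = qpoch (\<sigma> / \<phi> / t * q * q ^ m) q s * (\<phi> ^ s * qsgn q s)"
    proof -
      have "q / (\<phi> * q ^ s) = \<sigma> / \<phi> / t * q * q ^ m"
        using q nz by (simp add: t_def Ns(1) power_add)
      then show ?thesis
        using qpoch_reverse[of q \<phi> 0 s] q nz by (simp add: s_def qpoch_add)
    qed
    have x2: "qpoch (1 / q ^ N) q K * qpoch (1 / q ^ n) q j = qpoch q q N / (qpoch q q m * ((q * q ^ m) ^ s * qsgn q s))"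
    proof -
      have "1 / q ^ N * q ^ K = 1 / q ^ n"
        using q by (simp add: N power_add)
      then have "qpoch (1 / q ^ N) q K * qpoch (1 / q ^ n) q j = qpoch (1 / q ^ N) q s"
        by (simp add: s_def qpoch_add)
      moreover have "qpoch q q N = qpoch q q m * qpoch (1 / q ^ N) q s * ((q * q ^ m) ^ s * qsgn q s)"
        using qpoch_reverse[of q q m s] q by (simp add: Ns(3))
      ultimately show ?thesis
        using q qpoch_qq_nonzero[OF q1, of m] by (simp add: qsgn_nonzero)
    qed
    have y: "1 / (qpoch (\<sigma> * q / p) q K * qpoch (\<sigma> * q ^ K * q / p) q j)
       = qpoch (p / t) q m * ((\<sigma> * q ^ (K + j) * q / p) ^ m * qsgn q m) / qpoch (\<sigma> * q / p) q N"
      if "p \<noteq> 0" "qpoch (\<sigma> * q / p) q N \<noteq> 0" for p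
    proof -
      have "qpoch (\<sigma> * q ^ s * q / p) q m = qpoch (p / t) q m * ((\<sigma> * q ^ s * q / p) ^ m * qsgn q m)"
        using qpoch_reverse[of q "\<sigma> * q ^ s * q / p" 0 m] q nz that by (simp add: t_def Ns(1) power_add mult_ac)
      moreover have "qpoch (\<sigma> * q / p) q N = qpoch (\<sigma> * q / p) q s * qpoch (\<sigma> * q ^ s * q / p) q m"
        unfolding Ns(1) qpoch_add by (simp add: mult_ac)
      moreover have "qpoch (\<sigma> * q / p) q s = qpoch (\<sigma> * q / p) q K * qpoch (\<sigma> * q ^ K * q / p) q j"
        unfolding s_def qpoch_add by (simp add: mult_ac)
      ultimately have "qpoch (\<sigma> * q / p) q N = qpoch (\<sigma> * q / p) q K * qpoch (\<sigma> * q ^ K * q / p) q j *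
          (qpoch (p / t) q m * ((\<sigma> * q ^ (K + j) * q / p) ^ m * qsgn q m))"
        by (simp only: s_def)
      then show ?thesis
        using that(2) by (simp add: field_simps)
    qed
    have v: "1 - \<sigma> * q ^ K * q ^ (2 * j) = - ((t * q ^ j - q ^ m) / q ^ m)"
      unfolding mult_2 power_add t_def Ns(1) s_def using q by (simp add: field_simps)
    have num: "q ^ K * (\<phi> ^ s * qsgn q s) * ((\<sigma> * q ^ (K + j) * q / \<beta>) ^ m * qsgn q m * ((\<sigma> * q ^ (K + j) * q / \<delta>\<^sub>1) ^ m * qsgn q m) * ((\<sigma> * q ^ (K + j) * q / \<delta>\<^sub>2) ^ m * qsgn q m)) * (q / A) ^ j
     / ((q * q ^ m) ^ s * qsgn q s * ((\<sigma> * q ^ s) ^ m * qsgn q m) * q ^ m)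
    = \<phi> ^ N * A ^ K / A ^ N"
      using terminating_8W7_powers[OF q nz, of A K j m] unfolding A Ns(1) s_def by blast
    have qm: "q ^ m \<noteq> 0"
      using q by simp
    have tq: "t * q / t = q"
      using t by simp
    show ?thesis
      unfolding W_term_def qpochs_def list.map prod_list.Cons prod_list.Nil mult_1_right params
        qpair_def m_def[symmetric] Ns(2) tq
      by (rule terminating_8W7_term_cancel[OF \<sigma>s(2) t(2) qm x3 x1 x2 y[OF nz(2) nzp(1)] y[OF nz(3) nzp(2)] y[OF nz(4) nzp(3)] v num])
  qed
  have W: "W (\<sigma> * q ^ K) [\<beta>, \<delta>\<^sub>1, \<delta>\<^sub>2, \<phi> * q ^ K, 1 / q ^ n] q (q / A)
      = (\<Sum>j\<le>n. W_term (\<sigma> * q ^ K) [\<beta>, \<delta>\<^sub>1, \<delta>\<^sub>2, \<phi> * q ^ K, 1 / q ^ n] q (q / A) j)"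
    by (rule W_terminating) (use q in \<open>simp_all add: powi\<close>)
  show ?thesis
    unfolding u KN powi one_pair_sum_def t_def[symmetric] n_def[symmetric] W sum_distrib_left
    by (intro sum.cong refl termwise) simp
qed

text \<open>
  The factor that \<open>l = N - L\<close> contributes, rewritten in terms of \<open>L\<close> by reversal.
\<close>
lemma one_pair_term_reversed:
  fixes q \<sigma> \<beta> \<delta>\<^sub>1 \<delta>\<^sub>2 \<phi> A :: complex
  assumes q: "q \<noteq> 0" "norm q < 1" and nz: "\<sigma> \<noteq> 0" "\<beta> \<noteq> 0" "\<delta>\<^sub>1 \<noteq> 0" "\<delta>\<^sub>2 \<noteq> 0" "\<phi> \<noteq> 0"
    and N: "N = l + L"
    and A: "A = \<beta> * \<delta>\<^sub>1 * \<delta>\<^sub>2 * \<phi> / (\<sigma> ^ 2 * q ^ (N + 1))"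
    and z: "qpoch (\<sigma> * q / \<phi>) q N \<noteq> 0"
    and dens: "qpoch (\<phi> * \<beta> / (\<sigma> * q ^ N)) q L \<noteq> 0" "qpoch (\<phi> * \<delta>\<^sub>1 / (\<sigma> * q ^ N)) q L \<noteq> 0" "qpoch (\<phi> * \<delta>\<^sub>2 / (\<sigma> * q ^ N)) q L \<noteq> 0"
  shows "qpoch q q N / A ^ N * one_pair_term q (\<sigma> * q ^ N) \<beta> \<delta>\<^sub>1 \<delta>\<^sub>2 N (\<sigma> / \<phi>) l
    = qpoch (\<sigma> * q / (\<beta> * \<phi>)) q N * qpoch (\<sigma> * q / (\<delta>\<^sub>1 * \<phi>)) q N * qpoch (\<sigma> * q / (\<delta>\<^sub>2 * \<phi>)) q N / qpoch (\<sigma> * q / \<phi>) q N *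
      (qpoch (\<phi> / (\<sigma> * q ^ N)) q L * qpoch \<phi> q L * qpoch (1 / q ^ N) q L /
        (qpoch (\<phi> * \<beta> / (\<sigma> * q ^ N)) q L * qpoch (\<phi> * \<delta>\<^sub>1 / (\<sigma> * q ^ N)) q L * qpoch (\<phi> * \<delta>\<^sub>2 / (\<sigma> * q ^ N)) q L) * q ^ L)"
proof -
  define x where "x p = \<sigma> * q / (p * \<phi>)" for p
  define S where "S = qsgn q L"
  have S: "S \<noteq> 0" "S * S * q ^ L = q ^ (L * L)"
    using q by (simp_all add: S_def qsgn_nonzero qsgn_square)
  have A0: "A \<noteq> 0"
    using q nz by (simp add: A)
  have rev: "qpoch r q N = qpoch r q l * qpoch (q / (r * q ^ N)) q L * ((r * q ^ l) ^ L * S)" if "r \<noteq> 0" for r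
    unfolding N S_def by (rule qpoch_reverse[OF q(1) that])
  have X: "qpoch (x p) q N = qpoch (x p) q l * qpoch (\<phi> * p / (\<sigma> * q ^ N)) q L * ((x p * q ^ l) ^ L * S)" if "p \<noteq> 0" for p
  proof -
    have "q / (x p * q ^ N) = \<phi> * p / (\<sigma> * q ^ N)"
      using q nz that by (simp add: x_def)
    moreover have "x p \<noteq> 0"
      using q nz that by (simp add: x_def)
    ultimately show ?thesis
      using rev[of "x p"] by simp
  qed
  have Q: "qpoch q q N = qpoch q q l * qpoch (1 / q ^ N) q L * ((q * q ^ l) ^ L * S)"
    using rev[OF q(1)] q by simp
  have Z: "qpoch (\<sigma> * q / \<phi>) q N = qpoch (\<sigma> * q / \<phi>) q l * qpoch (\<phi> / (\<sigma> * q ^ N)) q L * ((\<sigma> * q / \<phi> * q ^ l) ^ L * S)"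
  proof -
    have "q / (\<sigma> * q / \<phi> * q ^ N) = \<phi> / (\<sigma> * q ^ N)"
      using q nz by simp
    then show ?thesis
      using rev[of "\<sigma> * q / \<phi>"] q nz by simp
  qed
  have F: "qpoch \<phi> q L = qpoch (\<sigma> / \<phi> / (\<sigma> * q ^ N) * q * q ^ l) q L * (\<phi> ^ L * S)"
  proof -
    have "q / (\<phi> * q ^ L) = \<sigma> / \<phi> / (\<sigma> * q ^ N) * q * q ^ l"
      using q nz by (simp add: N power_add)
    then show ?thesis
      using qpoch_reverse[of q \<phi> 0 L] q nz by (simp add: S_def)
  qed
  have fall: "qfall q (\<sigma> / \<phi>) p l = p ^ l * qpoch (x p) q l" if "p \<noteq> 0" for p
    using that by (simp add: qfall_eq_qpoch x_def mult_ac)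
  have "1 / (\<sigma> * q ^ N * (\<sigma> / \<phi>) * q) * \<beta> * \<delta>\<^sub>1 * \<delta>\<^sub>2 = A"
    by (simp add: A power2_eq_square mult_ac)
  then have Al: "(1 / (\<sigma> * q ^ N * (\<sigma> / \<phi>) * q)) ^ l * (\<beta> ^ l * \<delta>\<^sub>1 ^ l * \<delta>\<^sub>2 ^ l) = A ^ l"
    by (metis (no_types, lifting) mult.assoc power_mult_distrib)
  have num: "(q * q ^ l) ^ L * S * ((\<sigma> * q / \<phi> * q ^ l) ^ L * S)
      = A ^ L * q ^ L * ((x \<beta> * q ^ l) ^ L * S * ((x \<delta>\<^sub>1 * q ^ l) ^ L * S) * ((x \<delta>\<^sub>2 * q ^ l) ^ L * S)) * (\<phi> ^ L * S)"
  proof -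
    have qL: "q ^ L \<noteq> 0"
      using q by simp
    have "q * (q * q ^ l) * (\<sigma> * q / \<phi> * q ^ l) = A * q * (x \<beta> * q ^ l) * (x \<delta>\<^sub>1 * q ^ l) * (x \<delta>\<^sub>2 * q ^ l) * \<phi> * q ^ L"
      using q nz by (simp add: A x_def N power_add field_simps power2_eq_square)
    then have "(q * (q * q ^ l) * (\<sigma> * q / \<phi> * q ^ l)) ^ L = (A * q * (x \<beta> * q ^ l) * (x \<delta>\<^sub>1 * q ^ l) * (x \<delta>\<^sub>2 * q ^ l) * \<phi> * q ^ L) ^ L"
      by (rule arg_cong)
    then have "q ^ L * (q * q ^ l) ^ L * (\<sigma> * q / \<phi> * q ^ l) ^ L
        = A ^ L * q ^ L * (x \<beta> * q ^ l) ^ L * (x \<delta>\<^sub>1 * q ^ l) ^ L * (x \<delta>\<^sub>2 * q ^ l) ^ L * \<phi> ^ L * (S * S * q ^ L)"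
      unfolding S(2) power_mult_distrib[of "q * _"] power_mult_distrib[of q] power_mult_distrib[of "A * _"] power_mult_distrib[of A]
        power_mult_distrib[of _ "q ^ L"] power_mult_distrib[of _ \<phi>] power_mult_distrib[of _ "x _ * _"] power_mult
      by simp
    then have "q ^ L * ((q * q ^ l) ^ L * (\<sigma> * q / \<phi> * q ^ l) ^ L)
        = q ^ L * (A ^ L * q ^ L * (x \<beta> * q ^ l) ^ L * (x \<delta>\<^sub>1 * q ^ l) ^ L * (x \<delta>\<^sub>2 * q ^ l) ^ L * \<phi> ^ L * (S * S))"
      by (simp only: mult_ac)
    then have "(q * q ^ l) ^ L * (\<sigma> * q / \<phi> * q ^ l) ^ L
        = A ^ L * q ^ L * (x \<beta> * q ^ l) ^ L * (x \<delta>\<^sub>1 * q ^ l) ^ L * (x \<delta>\<^sub>2 * q ^ l) ^ L * \<phi> ^ L * (S * S)"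
      by (simp only: mult_left_cancel[OF qL])
    then have "((q * q ^ l) ^ L * (\<sigma> * q / \<phi> * q ^ l) ^ L) * (S * S)
        = (A ^ L * q ^ L * (x \<beta> * q ^ l) ^ L * (x \<delta>\<^sub>1 * q ^ l) ^ L * (x \<delta>\<^sub>2 * q ^ l) ^ L * \<phi> ^ L * (S * S)) * (S * S)"
      by (rule arg_cong)
    then show ?thesis
      by (simp only: mult_ac)
  qed
  have cancel: "(q1 * Qp * p1) / (Al * AL) * (Al * (X1 * X2 * X3) / (q1 * z1) * F1)
      = (X1 * Y1 * r1) * (X2 * Y2 * r2) * (X3 * Y3 * r3) / (z1 * Zp * p2) * (Zp * (F1 * r4) * Qp / (Y1 * Y2 * Y3) * qL)"
    if "p1 * p2 = AL * qL * (r1 * r2 * r3) * r4" "q1 \<noteq> 0" "z1 \<noteq> 0" "Zp \<noteq> 0" "p2 \<noteq> 0" "Al \<noteq> 0" "AL \<noteq> 0" "Y1 \<noteq> 0" "Y2 \<noteq> 0" "Y3 \<noteq> 0"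
    for q1 Qp p1 Al AL X1 X2 X3 z1 F1 Y1 Y2 Y3 r1 r2 r3 r4 Zp p2 qL :: complex
  proof -
    have "(q1 * Qp * p1) / (Al * AL) * (Al * (X1 * X2 * X3) / (q1 * z1) * F1) = (p1 * p2) * (Qp * (X1 * X2 * X3) * F1) / (AL * z1 * p2)"
      using that(2-) by simp
    also have "\<dots> = (X1 * Y1 * r1) * (X2 * Y2 * r2) * (X3 * Y3 * r3) / (z1 * Zp * p2) * (Zp * (F1 * r4) * Qp / (Y1 * Y2 * Y3) * qL)"
      unfolding that(1) using that(2-) by simp
    finally show ?thesis .
  qed
  have nonzero: "qpoch (\<sigma> * q / \<phi>) q l \<noteq> 0" "qpoch (\<phi> / (\<sigma> * q ^ N)) q L \<noteq> 0" "(\<sigma> * q / \<phi> * q ^ l) ^ L * S \<noteq> 0"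
    using z unfolding Z by auto
  have "one_pair_term q (\<sigma> * q ^ N) \<beta> \<delta>\<^sub>1 \<delta>\<^sub>2 N (\<sigma> / \<phi>) l = A ^ l * (qpoch (x \<beta>) q l * qpoch (x \<delta>\<^sub>1) q l * qpoch (x \<delta>\<^sub>2) q l) /
      (qpoch q q l * qpoch (\<sigma> * q / \<phi>) q l) * qpoch (\<sigma> / \<phi> / (\<sigma> * q ^ N) * q * q ^ l) q L"
    unfolding one_pair_term_def fall[OF nz(2)] fall[OF nz(3)] fall[OF nz(4)] Al[symmetric]
    by (simp add: N mult_ac)
  moreover have "qpoch q q N / A ^ N * (A ^ l * (qpoch (x \<beta>) q l * qpoch (x \<delta>\<^sub>1) q l * qpoch (x \<delta>\<^sub>2) q l) /
      (qpoch q q l * qpoch (\<sigma> * q / \<phi>) q l) * qpoch (\<sigma> / \<phi> / (\<sigma> * q ^ N) * q * q ^ l) q L)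
    = qpoch (x \<beta>) q N * qpoch (x \<delta>\<^sub>1) q N * qpoch (x \<delta>\<^sub>2) q N / qpoch (\<sigma> * q / \<phi>) q N *
      (qpoch (\<phi> / (\<sigma> * q ^ N)) q L * qpoch \<phi> q L * qpoch (1 / q ^ N) q L /
        (qpoch (\<phi> * \<beta> / (\<sigma> * q ^ N)) q L * qpoch (\<phi> * \<delta>\<^sub>1 / (\<sigma> * q ^ N)) q L * qpoch (\<phi> * \<delta>\<^sub>2 / (\<sigma> * q ^ N)) q L) * q ^ L)"
  proof -
    have AN: "A ^ N = A ^ l * A ^ L"
      by (simp add: N power_add)
    show ?thesis
      unfolding X[OF nz(2)] X[OF nz(3)] X[OF nz(4)] Z Q F AN
      by (rule cancel[OF num]) (use q A0 nonzero dens qpoch_qq_nonzero in auto)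
  qed
  ultimately show ?thesis
    unfolding x_def by simp
qed

section \<open>The double series transformation\<close>

theorem mainTheorem3:
  fixes q t b c d\<^sub>1 d\<^sub>2 e f \<sigma> \<beta> \<delta>\<^sub>1 \<delta>\<^sub>2 \<phi> :: complex
    and N :: nat
  assumes "0 < norm q" and "norm q < 1"
    and "t \<noteq> 0" "b \<noteq> 0" "c \<noteq> 0" "d\<^sub>1 \<noteq> 0" "d\<^sub>2 \<noteq> 0" "e \<noteq> 0" "f \<noteq> 0"
    and "\<sigma> \<noteq> 0" "\<beta> \<noteq> 0" "\<delta>\<^sub>1 \<noteq> 0" "\<delta>\<^sub>2 \<noteq> 0" "\<phi> \<noteq> 0"
    and "t^3 * \<sigma>^2 * q^(N+3) = b * c * d\<^sub>1 * d\<^sub>2 * e * f * \<beta> * \<delta>\<^sub>1 * \<delta>\<^sub>2 * \<phi>"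
    and "\<And>K. K \<le> N \<Longrightarrow>
           qpochs [q, 1/t, q/e, q/f, \<sigma>*q/\<beta>, \<sigma>*q/\<delta>\<^sub>1, \<sigma>*q/\<delta>\<^sub>2] q K \<noteq> 0"
    and "\<And>K. K \<le> N \<Longrightarrow>
           W_generic (t * q powi (- int K))
             [b, c, d\<^sub>1, d\<^sub>2, e * q powi (- int K), f * q powi (- int K), q powi (- int K)] q K"
    and "\<And>K. K \<le> N \<Longrightarrow>
           W_generic (\<sigma> * q^K)
             [\<beta>, \<delta>\<^sub>1, \<delta>\<^sub>2, \<phi> * q^K, q powi (int K - int N)] q (N - K)"
    and "qpochs [\<sigma>*q/\<beta>, \<sigma>*q/\<phi>, \<sigma>*q/\<delta>\<^sub>1, \<sigma>*q/\<delta>\<^sub>2] q N \<noteq> 0"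
    and "\<And>L. L \<le> N \<Longrightarrow>
           qpochs [q, e/f, t*q/f, q/f, q powi (- int N) * \<phi> * \<beta> / \<sigma>,
             q powi (- int N) * \<delta>\<^sub>1 * \<phi> / \<sigma>, q powi (- int N) * \<delta>\<^sub>2 * \<phi> / \<sigma>] q L \<noteq> 0"
    and "\<And>L. L \<le> N \<Longrightarrow>
           W_generic (f * q powi (- int L) / e)
             [t*q/(c*e), t*q/(b*e), t*q/(d\<^sub>1*e), t*q/(d\<^sub>2*e),
              f * q powi (- int L) / t, f * q powi (- int L), q powi (- int L)] q L"
  shows
    "(\<Sum>K=0..N.
        qpochs [b/t, c/t, d\<^sub>1/t, d\<^sub>2/t, \<sigma>*q, \<phi>, q powi (- int N)] q K
        / qpochs [q, 1/t, q/e, q/f, \<sigma>*q/\<beta>, \<sigma>*q/\<delta>\<^sub>1, \<sigma>*q/\<delta>\<^sub>2] q K * q^K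
        * W (t * q powi (- int K))
            [b, c, d\<^sub>1, d\<^sub>2, e * q powi (- int K), f * q powi (- int K), q powi (- int K)]
            q (t^3 * q^3 / (b * c * d\<^sub>1 * d\<^sub>2 * e * f))
        * W (\<sigma> * q^K)
            [\<beta>, \<delta>\<^sub>1, \<delta>\<^sub>2, \<phi> * q^K, q powi (int K - int N)]
            q (\<sigma>^2 * q^(N+2) / (\<beta> * \<delta>\<^sub>1 * \<delta>\<^sub>2 * \<phi>)))
     = \<phi>^N
       * (qpochs [\<sigma>*q, \<sigma>*q/(\<beta>*\<phi>), \<sigma>*q/(\<delta>\<^sub>1*\<phi>), \<sigma>*q/(\<delta>\<^sub>2*\<phi>)] q N
          / qpochs [\<sigma>*q/\<beta>, \<sigma>*q/\<phi>, \<sigma>*q/\<delta>\<^sub>1, \<sigma>*q/\<delta>\<^sub>2] q N)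
       * (\<Sum>L=0..N.
            qpochs [t*q/(b*f), t*q/(c*f), t*q/(d\<^sub>1*f), t*q/(d\<^sub>2*f),
              q powi (- int N) * \<phi> / \<sigma>, \<phi>, q powi (- int N)] q L
            / qpochs [q, e/f, t*q/f, q/f, q powi (- int N) * \<phi> * \<beta> / \<sigma>,
                q powi (- int N) * \<delta>\<^sub>1 * \<phi> / \<sigma>, q powi (- int N) * \<delta>\<^sub>2 * \<phi> / \<sigma>] q L * q^L
            * W (f * q powi (- int L) / e)
                [t*q/(c*e), t*q/(b*e), t*q/(d\<^sub>1*e), t*q/(d\<^sub>2*e),
                 f * q powi (- int L) / t, f * q powi (- int L), q powi (- int L)]
                q (b * c * d\<^sub>1 * d\<^sub>2 * e * f * q powi (-1) / t^3))"
proof -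
  have q: "q \<noteq> 0" "norm q < 1"
    using assms(1,2) by auto
  note nz = assms(3-14)
  \<comment> \<open>The two parameters of the Euler transformations; the balancing condition makes them inverse.\<close>
  define A where "A = b * c * d\<^sub>1 * d\<^sub>2 / (t * (t / e) * (t / f) * q ^ 2)"
  define B where "B = \<beta> * \<delta>\<^sub>1 * \<delta>\<^sub>2 * \<phi> / (\<sigma> ^ 2 * q ^ (N + 1))"
  have "A * B = (b * c * d\<^sub>1 * d\<^sub>2 * e * f * \<beta> * \<delta>\<^sub>1 * \<delta>\<^sub>2 * \<phi>) / (t ^ 3 * \<sigma> ^ 2 * q ^ (N + 3))"
    using q nz by (simp add: A_def B_def power_add power2_eq_square power3_eq_cube mult_ac)
  then have AB: "A * B = 1"
    unfolding assms(15)[symmetric] using q nz by simp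
  have powi: "q powi (- int k) = 1 / q ^ k" for k
    by (simp add: power_int_minus inverse_eq_divide)
  have gen1: "t / q ^ k \<noteq> 1" "qpoch (t * q / e) q k \<noteq> 0" "qpoch (t * q / f) q k \<noteq> 0" "qpoch (t * q) q k \<noteq> 0"
    if "k \<le> N" for k
    using assms(17)[OF that] q unfolding W_generic_def qpochs_def powi by auto
  have gen2: "\<sigma> * q ^ k \<noteq> 1" if "k \<le> N" for k
    using assms(18)[OF that] unfolding W_generic_def by auto
  have "qpoch (\<sigma> * q / (1 / q ^ N)) q N \<noteq> 0"
    using assms(18)[of 0] unfolding W_generic_def qpochs_def by (auto simp: powi)
  then have gen2': "qpoch (\<sigma> * q ^ N * q) q N \<noteq> 0"
    by (simp add: mult_ac)
  have gen3: "f / e / q ^ k \<noteq> 1" "qpoch (f * q / e) q k \<noteq> 0"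
    if "k \<le> N" for k
    using assms(21)[OF that] q unfolding W_generic_def qpochs_def powi by (auto simp: mult_ac)
  \<comment> \<open>Factorials \<open>(q/t)_k\<close>, \<open>(eq/f)_k\<close> do not occur among the denominators; they are nonzero because the leading parameters of all the series are different from \<open>1\<close>.\<close>
  have no_root: "qpoch (x * q) q k \<noteq> 0" if "\<And>i. i \<le> N \<Longrightarrow> 1 / x / q ^ i \<noteq> 1" "k \<le> N" for x k
  proof
    assume "qpoch (x * q) q k = 0"
    then obtain i where i: "i < k" "x * q ^ Suc i = 1"
      by (auto simp: qpoch_eq_0_iff mult_ac)
    then have "x \<noteq> 0"
      by auto
    then have "1 / x / q ^ Suc i = 1"
      using i(2) q by (simp add: field_simps)
    then show False
      using that(1)[of "Suc i"] that(2) i(1) by simp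
  qed
  have pre: "qpochs [q, 1 / t, q / e, q / f] q k \<noteq> 0" "qpoch (q / e) q k \<noteq> 0" "qpoch (q / f) q k \<noteq> 0" if "k \<le> N" for k
    using assms(16)[OF that] by (simp_all add: qpochs_def)
  have euler: "vwp_sum q t b c d\<^sub>1 d\<^sub>2 (t / e) (t / f) k = (\<Sum>l\<le>k. qbin q A (k - l) * dual_sum q t b c d\<^sub>1 d\<^sub>2 (t / e) (t / f) l)"
    if k: "k \<le> N" for k
  proof -
    have ratio: "t / e / (t / f) = f / e" "t / f / (t / e) = e / f" "t / e / t = 1 / e" "t / f / t = 1 / f"
      using nz by simp_all
    have "e \<noteq> f"
      using gen3(1)[of 0] nz by auto
    then have "t / e \<noteq> t / f"
      using nz by simp
    moreover have "qpoch (1 / t * q) q k \<noteq> 0" "qpoch (e / f * q) q k \<noteq> 0"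
      using gen1(1) gen3(1) k nz by (intro no_root; simp)+
    ultimately have "vwp_sum q t b c d\<^sub>1 d\<^sub>2 (t / e) (t / f) k = euler_sum q t b c d\<^sub>1 d\<^sub>2 (t / e) (t / f) k"
      using q nz gen1(1)[of 0] gen1(2-4)[OF k] gen3(2)[OF k] pre(2,3)[OF k]
      by (intro euler_transformation) (simp_all add: ratio mult_ac)
    then show ?thesis
      unfolding euler_sum_def A_def .
  qed
  define C where "C = qpoch (\<sigma> * q) q N * qpoch q q N / (qpoch (\<sigma> * q / \<beta>) q N * qpoch (\<sigma> * q / \<delta>\<^sub>1) q N * qpoch (\<sigma> * q / \<delta>\<^sub>2) q N)"
  define y where "y l = one_pair_term q (\<sigma> * q ^ N) \<beta> \<delta>\<^sub>1 \<delta>\<^sub>2 N (\<sigma> / \<phi>) l" for l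
  define G where "G l = vwp_sum q (f / e) (t * q / (c * e)) (t * q / (b * e)) (t * q / (d\<^sub>1 * e)) (t * q / (d\<^sub>2 * e)) (t / e) (1 / e) l" for l
  have dual: "dual_sum q t b c d\<^sub>1 d\<^sub>2 (t / e) (t / f) l = A ^ l * G l" for l
    using dual_sum_eq_vwp_sum[of b c d\<^sub>1 d\<^sub>2 "t / e" "t / f" q t l] nz by (simp add: A_def G_def mult_ac)
  have nzN: "qpoch (\<sigma> * q / \<beta>) q N \<noteq> 0" "qpoch (\<sigma> * q / \<delta>\<^sub>1) q N \<noteq> 0" "qpoch (\<sigma> * q / \<delta>\<^sub>2) q N \<noteq> 0" "qpoch (\<sigma> * q / \<phi>) q N \<noteq> 0"
    using assms(19) by (simp_all add: qpochs_def)
  have single: "one_pair_sum q (\<sigma> * q ^ N) \<beta> \<delta>\<^sub>1 \<delta>\<^sub>2 N k (\<sigma> / \<phi>) = (\<Sum>l\<le>k. qbin q B (k - l) * y l)" if k: "k \<le> N" for k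
  proof -
    have "qpoch (1 / (\<sigma> * q ^ N) * q) q k \<noteq> 0"
    proof (rule no_root[OF _ k])
      fix i assume "i \<le> N"
      then have "1 / (1 / (\<sigma> * q ^ N)) / q ^ i = \<sigma> * q ^ (N - i)"
        using q by (simp add: power_diff)
      then show "1 / (1 / (\<sigma> * q ^ N)) / q ^ i \<noteq> 1"
        using gen2[of "N - i"] by simp
    qed
    moreover have "\<beta> * \<delta>\<^sub>1 * \<delta>\<^sub>2 / (\<sigma> * q ^ N * (\<sigma> / \<phi>) * q) = B"
      by (simp add: B_def power2_eq_square mult_ac)
    moreover have "one_pair_sum q (\<sigma> * q ^ N) \<beta> \<delta>\<^sub>1 \<delta>\<^sub>2 N k (\<sigma> / \<phi>)
      = (\<Sum>l\<le>k. qbin q (\<beta> * \<delta>\<^sub>1 * \<delta>\<^sub>2 / (\<sigma> * q ^ N * (\<sigma> / \<phi>) * q)) (k - l) * one_pair_term q (\<sigma> * q ^ N) \<beta> \<delta>\<^sub>1 \<delta>\<^sub>2 N (\<sigma> / \<phi>) l)"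
      using q nz gen2[of N] qpoch_nonzero_mono[OF gen2' k] qpoch_nonzero_mono[OF nzN(4) k] k calculation(1)
      by (intro one_pair_transformation) simp_all
    ultimately show ?thesis
      unfolding y_def by simp
  qed
  have W10: "qpochs [b / t, c / t, d\<^sub>1 / t, d\<^sub>2 / t] q K / qpochs [q, 1 / t, q / e, q / f] q K *
      W (t * q powi (- int K)) [b, c, d\<^sub>1, d\<^sub>2, e * q powi (- int K), f * q powi (- int K), q powi (- int K)]
        q (t ^ 3 * q ^ 3 / (b * c * d\<^sub>1 * d\<^sub>2 * e * f))
    = vwp_sum q t b c d\<^sub>1 d\<^sub>2 (t / e) (t / f) K" if "K \<le> N" for K
    using gen1(1)[of 0] by (intro vwp_sum_eq_W q nz pre(1)[OF that] assms(17)[OF that]) simp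
  have W8: "q ^ K * (qpochs [\<sigma> * q, \<phi>, q powi (- int N)] q K / qpochs [\<sigma> * q / \<beta>, \<sigma> * q / \<delta>\<^sub>1, \<sigma> * q / \<delta>\<^sub>2] q K) *
      W (\<sigma> * q ^ K) [\<beta>, \<delta>\<^sub>1, \<delta>\<^sub>2, \<phi> * q ^ K, q powi (int K - int N)] q (\<sigma> ^ 2 * q ^ (N + 2) / (\<beta> * \<delta>\<^sub>1 * \<delta>\<^sub>2 * \<phi>))
    = C * (\<phi> ^ N * B ^ K / B ^ N) * one_pair_sum q (\<sigma> * q ^ N) \<beta> \<delta>\<^sub>1 \<delta>\<^sub>2 N (N - K) (\<sigma> / \<phi>)" if "K \<le> N" for K
    unfolding C_def using gen2 nzN q by (intro terminating_8W7 nz that) (simp_all add: B_def)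
  \<comment> \<open>The case \<open>f/e\<close>, \<open>f/t\<close>, \<open>f\<close> of the same identity in place of \<open>t\<close>, \<open>e\<close>, \<open>f\<close>.\<close>
  have W10': "qpochs [t * q / (b * f), t * q / (c * f), t * q / (d\<^sub>1 * f), t * q / (d\<^sub>2 * f)] q L / qpochs [q, e / f, t * q / f, q / f] q L *
      W (f * q powi (- int L) / e)
                [t*q/(c*e), t*q/(b*e), t*q/(d\<^sub>1*e), t*q/(d\<^sub>2*e),
                 f * q powi (- int L) / t, f * q powi (- int L), q powi (- int L)]
                q (b * c * d\<^sub>1 * d\<^sub>2 * e * f * q powi (-1) / t^3) = G L" if L: "L \<le> N" for L
  proof -
    have eqs: "f / e * z = f * z / e" "f / t * z = f * z / t" for z
      by simp_all
    have heads: "t * q / (p * e) / (f / e) = t * q / (p * f)" "1 / (f / e) = e / f" "q / (f / t) = t * q / f" "f / e / (f / t) = t / e" "f / e / f = 1 / e" for p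
      using nz by (simp_all add: mult_ac)
    have arg: "(f / e) ^ 3 * q ^ 3 / (t * q / (c * e) * (t * q / (b * e)) * (t * q / (d\<^sub>1 * e)) * (t * q / (d\<^sub>2 * e)) * (f / t) * f)
        = b * c * d\<^sub>1 * d\<^sub>2 * e * f * q powi (-1) / t^3"
      using q nz by (simp add: power_int_minus field_simps power3_eq_cube)
    have "f / e \<noteq> 1"
      using gen3(1)[of 0] by simp
    moreover have "qpochs [q, 1 / (f / e), q / (f / t), q / f] q L \<noteq> 0"
      using assms(20)[OF L] unfolding heads by (simp add: qpochs_def)
    moreover have "W_generic (f / e * q powi (- int L))
       [t * q / (c * e), t * q / (b * e), t * q / (d\<^sub>1 * e), t * q / (d\<^sub>2 * e), f / t * q powi (- int L), f * q powi (- int L), q powi (- int L)] q L"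
      unfolding eqs using assms(21)[OF L] .
    ultimately have "qpochs [t * q / (c * e) / (f / e), t * q / (b * e) / (f / e), t * q / (d\<^sub>1 * e) / (f / e), t * q / (d\<^sub>2 * e) / (f / e)] q L /
        qpochs [q, 1 / (f / e), q / (f / t), q / f] q L *
      W (f / e * q powi (- int L)) [t * q / (c * e), t * q / (b * e), t * q / (d\<^sub>1 * e), t * q / (d\<^sub>2 * e), f / t * q powi (- int L), f * q powi (- int L), q powi (- int L)]
        q ((f / e) ^ 3 * q ^ 3 / (t * q / (c * e) * (t * q / (b * e)) * (t * q / (d\<^sub>1 * e)) * (t * q / (d\<^sub>2 * e)) * (f / t) * f))
      = vwp_sum q (f / e) (t * q / (c * e)) (t * q / (b * e)) (t * q / (d\<^sub>1 * e)) (t * q / (d\<^sub>2 * e)) (f / e / (f / t)) (f / e / f) L"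
      using q nz by (intro vwp_sum_eq_W) simp_all
    then show ?thesis
      unfolding heads arg eqs G_def by (simp add: qpochs_def mult_ac)
  qed
  have last: "C / B ^ N * y (N - L) = qpochs [\<sigma>*q, \<sigma>*q/(\<beta>*\<phi>), \<sigma>*q/(\<delta>\<^sub>1*\<phi>), \<sigma>*q/(\<delta>\<^sub>2*\<phi>)] q N
          / qpochs [\<sigma>*q/\<beta>, \<sigma>*q/\<phi>, \<sigma>*q/\<delta>\<^sub>1, \<sigma>*q/\<delta>\<^sub>2] q N *
      (qpochs [q powi (- int N) * \<phi> / \<sigma>, \<phi>, q powi (- int N)] q L /
       qpochs [q powi (- int N) * \<phi> * \<beta> / \<sigma>, q powi (- int N) * \<delta>\<^sub>1 * \<phi> / \<sigma>, q powi (- int N) * \<delta>\<^sub>2 * \<phi> / \<sigma>] q L * q ^ L)"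
    if L: "L \<le> N" for L
  proof -
    have heads: "1 / q ^ N * \<phi> / \<sigma> = \<phi> / (\<sigma> * q ^ N)" "1 / q ^ N * \<phi> * p / \<sigma> = \<phi> * p / (\<sigma> * q ^ N)" "1 / q ^ N * p * \<phi> / \<sigma> = \<phi> * p / (\<sigma> * q ^ N)" for p
      by (simp_all add: mult_ac)
    have dens: "qpoch (\<phi> * \<beta> / (\<sigma> * q ^ N)) q L \<noteq> 0" "qpoch (\<phi> * \<delta>\<^sub>1 / (\<sigma> * q ^ N)) q L \<noteq> 0" "qpoch (\<phi> * \<delta>\<^sub>2 / (\<sigma> * q ^ N)) q L \<noteq> 0"
      using assms(20)[OF L] unfolding powi heads by (simp_all add: qpochs_def)
    have "qpoch q q N / B ^ N * y (N - L)
    = qpoch (\<sigma> * q / (\<beta> * \<phi>)) q N * qpoch (\<sigma> * q / (\<delta>\<^sub>1 * \<phi>)) q N * qpoch (\<sigma> * q / (\<delta>\<^sub>2 * \<phi>)) q N / qpoch (\<sigma> * q / \<phi>) q N *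
      (qpoch (\<phi> / (\<sigma> * q ^ N)) q L * qpoch \<phi> q L * qpoch (1 / q ^ N) q L /
        (qpoch (\<phi> * \<beta> / (\<sigma> * q ^ N)) q L * qpoch (\<phi> * \<delta>\<^sub>1 / (\<sigma> * q ^ N)) q L * qpoch (\<phi> * \<delta>\<^sub>2 / (\<sigma> * q ^ N)) q L) * q ^ L)"
      unfolding y_def using L by (intro one_pair_term_reversed q nz nzN(4) dens B_def) simp
    moreover have "C / B ^ N * y (N - L) = qpoch (\<sigma> * q) q N / (qpoch (\<sigma> * q / \<beta>) q N * qpoch (\<sigma> * q / \<delta>\<^sub>1) q N * qpoch (\<sigma> * q / \<delta>\<^sub>2) q N) *
       (qpoch q q N / B ^ N * y (N - L))"
      by (simp add: C_def)
    ultimately show ?thesis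
      unfolding powi heads qpochs_def list.map prod_list.Cons prod_list.Nil mult_1_right
      unfolding divide_inverse inverse_mult_distrib by (simp only: mult_ac)
  qed
  have lhs: "qpochs [b/t, c/t, d\<^sub>1/t, d\<^sub>2/t, \<sigma>*q, \<phi>, q powi (- int N)] q K
        / qpochs [q, 1/t, q/e, q/f, \<sigma>*q/\<beta>, \<sigma>*q/\<delta>\<^sub>1, \<sigma>*q/\<delta>\<^sub>2] q K * q^K * w * w'
      = (qpochs [b / t, c / t, d\<^sub>1 / t, d\<^sub>2 / t] q K / qpochs [q, 1 / t, q / e, q / f] q K * w) *
        (q ^ K * (qpochs [\<sigma> * q, \<phi>, q powi (- int N)] q K / qpochs [\<sigma> * q / \<beta>, \<sigma> * q / \<delta>\<^sub>1, \<sigma> * q / \<delta>\<^sub>2] q K) * w')" for K w w'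
    by (simp add: qpochs_def mult_ac)
  have rhs: "qpochs [t*q/(b*f), t*q/(c*f), t*q/(d\<^sub>1*f), t*q/(d\<^sub>2*f),
              q powi (- int N) * \<phi> / \<sigma>, \<phi>, q powi (- int N)] q L
            / qpochs [q, e/f, t*q/f, q/f, q powi (- int N) * \<phi> * \<beta> / \<sigma>,
                q powi (- int N) * \<delta>\<^sub>1 * \<phi> / \<sigma>, q powi (- int N) * \<delta>\<^sub>2 * \<phi> / \<sigma>] q L * q^L * w
      = (qpochs [q powi (- int N) * \<phi> / \<sigma>, \<phi>, q powi (- int N)] q L /
         qpochs [q powi (- int N) * \<phi> * \<beta> / \<sigma>, q powi (- int N) * \<delta>\<^sub>1 * \<phi> / \<sigma>, q powi (- int N) * \<delta>\<^sub>2 * \<phi> / \<sigma>] q L * q ^ L) *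
        (qpochs [t * q / (b * f), t * q / (c * f), t * q / (d\<^sub>1 * f), t * q / (d\<^sub>2 * f)] q L / qpochs [q, e / f, t * q / f, q / f] q L * w)" for L w
    by (simp add: qpochs_def mult_ac)
  have "(\<Sum>K=0..N.
        qpochs [b/t, c/t, d\<^sub>1/t, d\<^sub>2/t, \<sigma>*q, \<phi>, q powi (- int N)] q K
        / qpochs [q, 1/t, q/e, q/f, \<sigma>*q/\<beta>, \<sigma>*q/\<delta>\<^sub>1, \<sigma>*q/\<delta>\<^sub>2] q K * q^K
        * W (t * q powi (- int K))
            [b, c, d\<^sub>1, d\<^sub>2, e * q powi (- int K), f * q powi (- int K), q powi (- int K)]
            q (t^3 * q^3 / (b * c * d\<^sub>1 * d\<^sub>2 * e * f))
        * W (\<sigma> * q^K)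
            [\<beta>, \<delta>\<^sub>1, \<delta>\<^sub>2, \<phi> * q^K, q powi (int K - int N)]
            q (\<sigma>^2 * q^(N+2) / (\<beta> * \<delta>\<^sub>1 * \<delta>\<^sub>2 * \<phi>)))
    = C * \<phi> ^ N / B ^ N * (\<Sum>k\<le>N. B ^ k * (\<Sum>l\<le>k. qbin q A (k - l) * dual_sum q t b c d\<^sub>1 d\<^sub>2 (t / e) (t / f) l) *
        (\<Sum>l\<le>N - k. qbin q B (N - k - l) * y l))"
    unfolding lhs sum_distrib_left[of _ _ "{..N}"] atLeast0AtMost
  proof (intro sum.cong refl)
    fix k assume "k \<in> {..N}"
    then have k: "k \<le> N" by simp
    show "(qpochs [b / t, c / t, d\<^sub>1 / t, d\<^sub>2 / t] q k / qpochs [q, 1 / t, q / e, q / f] q k *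
        W (t * q powi (- int k))
            [b, c, d\<^sub>1, d\<^sub>2, e * q powi (- int k), f * q powi (- int k), q powi (- int k)]
            q (t^3 * q^3 / (b * c * d\<^sub>1 * d\<^sub>2 * e * f))) *
        (q ^ k * (qpochs [\<sigma> * q, \<phi>, q powi (- int N)] q k / qpochs [\<sigma> * q / \<beta>, \<sigma> * q / \<delta>\<^sub>1, \<sigma> * q / \<delta>\<^sub>2] q k) *
         W (\<sigma> * q^k)
            [\<beta>, \<delta>\<^sub>1, \<delta>\<^sub>2, \<phi> * q^k, q powi (int k - int N)]
            q (\<sigma>^2 * q^(N+2) / (\<beta> * \<delta>\<^sub>1 * \<delta>\<^sub>2 * \<phi>)))
      = C * \<phi> ^ N / B ^ N * (B ^ k * (\<Sum>l\<le>k. qbin q A (k - l) * dual_sum q t b c d\<^sub>1 d\<^sub>2 (t / e) (t / f) l) *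
        (\<Sum>l\<le>N - k. qbin q B (N - k - l) * y l))"
      unfolding W10[OF k] W8[OF k] euler[OF k] single[OF diff_le_self] by (simp add: mult_ac)
  qed
  also have "\<dots> = C * \<phi> ^ N / B ^ N * (\<Sum>l\<le>N. B ^ l * dual_sum q t b c d\<^sub>1 d\<^sub>2 (t / e) (t / f) l * y (N - l))"
    unfolding euler_convolution[OF q(2) AB] ..
  also have "\<dots> = \<phi> ^ N * (\<Sum>l\<le>N. (C / B ^ N * y (N - l)) * G l)"
  proof -
    have "B ^ l * (A ^ l * g) = g" for g l
    proof -
      have "B ^ l * (A ^ l * g) = (A * B) ^ l * g"
        by (simp only: power_mult_distrib mult_ac)
      then show ?thesis
        by (simp add: AB)
    qed
    then show ?thesis
      unfolding dual sum_distrib_left by (intro sum.cong refl) simp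
  qed
  also have "(\<Sum>l\<le>N. (C / B ^ N * y (N - l)) * G l)
    = qpochs [\<sigma>*q, \<sigma>*q/(\<beta>*\<phi>), \<sigma>*q/(\<delta>\<^sub>1*\<phi>), \<sigma>*q/(\<delta>\<^sub>2*\<phi>)] q N
          / qpochs [\<sigma>*q/\<beta>, \<sigma>*q/\<phi>, \<sigma>*q/\<delta>\<^sub>1, \<sigma>*q/\<delta>\<^sub>2] q N *
      (\<Sum>L=0..N.
            qpochs [t*q/(b*f), t*q/(c*f), t*q/(d\<^sub>1*f), t*q/(d\<^sub>2*f),
              q powi (- int N) * \<phi> / \<sigma>, \<phi>, q powi (- int N)] q L
            / qpochs [q, e/f, t*q/f, q/f, q powi (- int N) * \<phi> * \<beta> / \<sigma>,
                q powi (- int N) * \<delta>\<^sub>1 * \<phi> / \<sigma>, q powi (- int N) * \<delta>\<^sub>2 * \<phi> / \<sigma>] q L * q^L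
            * W (f * q powi (- int L) / e)
                [t*q/(c*e), t*q/(b*e), t*q/(d\<^sub>1*e), t*q/(d\<^sub>2*e),
                 f * q powi (- int L) / t, f * q powi (- int L), q powi (- int L)]
                q (b * c * d\<^sub>1 * d\<^sub>2 * e * f * q powi (-1) / t^3))"
    unfolding rhs sum_distrib_left atLeast0AtMost
    by (intro sum.cong refl, unfold atMost_iff) (subst W10', assumption, subst last, assumption, rule mult.assoc)
  finally show ?thesis
    unfolding mult.assoc[of "\<phi> ^ N"] .
qed

end
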